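(* For any $r\ge0$ let $\mathcal{S}_r$ be the open square with vertices $(\pm e^{-r},\pm e^{-r})$ and let $f_r$ be its indicator function. Then $$\|\hat f_r\|_2^2=\frac{8}{\zeta(2)}\left(e^{-2r}+\int_{\mathcal{D}_r}\Big(\frac{e^{-r}}{x_1}+\frac{e^{-r}}{x_2}-\frac{1}{x_1x_2}\Big)\,dx_1\,dx_2\right),$$ where $\mathcal{D}_r=\{(x_1,x_2)\in\mathcal{S}_r:\ x_1>0,\ x_2>0,\ x_1+x_2>e^r\}$.
   Context: $X=\mathrm{SL}_2(\mathbb{R})/\mathrm{SL}_2(\mathbb{Z})$ is the space of unimodular lattices in $\mathbb{R}^2$ and $\mu$ is the $\mathrm{SL}_2(\mathbb{R})$-invariant probability measure on $X$. For a lattice $\Lambda$, $\Lambda_{\mathrm{pr}}$ denotes its set of primitive vectors. For a function $f$ on $\mathbb{R}^2$, its primitive Siegel transform is $\hat f(\Lambda)=\sum_{v\in\Lambda_{\mathrm{pr}}}f(v)$, a function on $X$. $\|\cdot\|_2$ is the $L^2(X,\mu)$ norm. $\zeta(2)=\pi^2/6$. *)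

theory Defs
  imports "HOL-Analysis.Analysis"
begin

definition lattice_span :: "real \<times> real \<Rightarrow> real \<times> real \<Rightarrow> (real \<times> real) set" where
  "lattice_span b1 b2 = {of_int m *\<^sub>R b1 + of_int n *\<^sub>R b2 | m n :: int. True}"

definition primitive_vectors :: "(real \<times> real) set \<Rightarrow> (real \<times> real) set" where
  "primitive_vectors L = {v \<in> L. v \<noteq> 0 \<and>
      (\<forall>w\<in>L. \<forall>k::int. v = of_int k *\<^sub>R w \<longrightarrow> \<bar>k\<bar> = 1)}"

definition siegel_pr :: "(real \<times> real \<Rightarrow> real) \<Rightarrow> (real \<times> real) set \<Rightarrow> real" where
  "siegel_pr f L = (\<Sum>\<^sub>\<infinity>v\<in>primitive_vectors L. f v)"

definition rot :: "real \<Rightarrow> real \<times> real \<Rightarrow> real \<times> real" where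
  "rot t v = (cos t * fst v - sin t * snd v, sin t * fst v + cos t * snd v)"

text \<open>Coordinates (x,y,t) on X = SL2(R)/SL2(Z): the unimodular lattice
  k_t diag(y^(-1/2), y^(1/2)) [[1,x],[0,1]] Z^2, i.e. the lattice (Z + (x+iy) Z)/sqrt y
  rotated by the angle t.\<close>
definition lattice_coord :: "real \<times> real \<times> real \<Rightarrow> (real \<times> real) set" where
  "lattice_coord p = (case p of (x, y, t) \<Rightarrow>
     lattice_span (rot t (1 / sqrt y, 0)) (rot t (x / sqrt y, sqrt y)))"

text \<open>Fundamental domain of SL2(Z) in SL2(R) in these coordinates: (x + iy) in the
  standard fundamental domain of the modular group, t in [0, pi).\<close>
definition fund_dom :: "(real \<times> real \<times> real) set" where
  "fund_dom = {(x, y, t). \<bar>x\<bar> \<le> 1/2 \<and> x\<^sup>2 + y\<^sup>2 \<ge> 1 \<and> 0 < y \<and> 0 \<le> t \<and> t < pi}"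

text \<open>The SL2(R)-invariant probability measure mu on X, in coordinates: Haar measure
  dx dy dt / y^2 restricted to the fundamental domain (total mass pi^2/3), normalized.\<close>
definition mu_X :: "(real \<times> real \<times> real) measure" where
  "mu_X = density lborel
     (\<lambda>p. ennreal (indicator fund_dom p * (3 / pi\<^sup>2) / (fst (snd p))\<^sup>2))"

definition L2_norm_sq :: "((real \<times> real) set \<Rightarrow> real) \<Rightarrow> real" where
  "L2_norm_sq F = (\<integral>p. (F (lattice_coord p))\<^sup>2 \<partial>mu_X)"

definition square_S :: "real \<Rightarrow> (real \<times> real) set" where
  "square_S r = {v. \<bar>fst v\<bar> < exp (-r) \<and> \<bar>snd v\<bar> < exp (-r)}"

definition f_ind :: "real \<Rightarrow> real \<times> real \<Rightarrow> real" where
  "f_ind r = indicator (square_S r)"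

definition D_reg :: "real \<Rightarrow> (real \<times> real) set" where
  "D_reg r = {v \<in> square_S r. 0 < fst v \<and> 0 < snd v \<and> fst v + snd v > exp r}"

definition zeta2 :: real where "zeta2 = pi\<^sup>2 / 6"

end

theory Submission
  imports Defs
begin

text \<open>
  Let \<open>\<epsilon> = exp (-r) \<le> 1\<close>. Two vectors of a unimodular lattice have integral determinant, and two vectors
  of the square \<open>S\<close> have determinant less than 2 in absolute value. Hence a pair of primitive lattice
  vectors in \<open>S\<close> is either \<open>(v, v)\<close>, \<open>(v, -v)\<close> or a basis of the lattice, and
  exactly one of \<open>(v, w)\<close>, \<open>(w, v)\<close> is positively oriented in the latter case.
  Moreover, each primitive \<open>v\<close> extends to exactly one positive basis \<open>(v, w)\<close> with
  \<open>0 \<le> Re (w / v) < 1\<close>. The square of the Siegel transform of the indicator \<open>f\<close> of \<open>S\<close> is therefore the sum of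
  \<open>2 f(v) (1\<^sub>[\<^sub>0\<^sub>,\<^sub>1\<^sub>)(Re (w / v)) + f(w))\<close> over all positive bases \<open>(v, w)\<close>, that is, over
  \<open>SL\<^sub>2(\<int>)\<close>. Unfolding against the modular group turns its mean into an integral over
  \<open>SL\<^sub>2(\<real>)\<close>, parametrised by \<open>v\<close> in the plane and \<open>x = Re (w / v)\<close>. The first summand contributes the area of
  \<open>S\<close>, the second one the length in \<open>x\<close> of the chord of \<open>S\<close> on the line \<open>det (v, w) = 1\<close>; for \<open>v\<close>
  in the first quadrant this length is \<open>\<epsilon>/v\<^sub>1 + \<epsilon>/v\<^sub>2 - 1/(v\<^sub>1 v\<^sub>2)\<close> if \<open>v\<^sub>1 + v\<^sub>2 > 1/\<epsilon>\<close>, and zero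
  otherwise.
\<close>

section \<open>Substitution and periodicity for nonnegative integrals\<close>

text \<open>Links the gauge integral, in which the change of variables theorem is phrased, to
  nonnegative Lebesgue integrals. An equivalence for every finite value \<open>b\<close> also
  controls the infinite case later.\<close>

lemma has_integral_iff_set_nn_integral:
  fixes h :: "real \<Rightarrow> real"
  assumes [measurable]: "h \<in> borel_measurable borel" "S \<in> sets borel"
    and nonneg: "\<And>x. 0 \<le> h x" and b: "0 \<le> b"
  shows "(h has_integral b) S \<longleftrightarrow> (\<integral>\<^sup>+x\<in>S. ennreal (h x) \<partial>lborel) = ennreal b"
proof
  assume "(h has_integral b) S"
  then show "(\<integral>\<^sup>+x\<in>S. ennreal (h x) \<partial>lborel) = ennreal b"
    using nn_integral_has_integral_lebesgue'[of S h b] nonneg by simp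
next
  assume eq: "(\<integral>\<^sup>+x\<in>S. ennreal (h x) \<partial>lborel) = ennreal b"
  have "((\<lambda>x. h x * indicator S x) has_integral b) UNIV"
  proof (rule nn_integral_has_integral)
    show "(\<integral>\<^sup>+x. ennreal (h x * indicator S x) \<partial>lborel) = ennreal b"
      by (subst eq[symmetric], rule nn_integral_cong) (auto split: split_indicator)
  qed (use nonneg b in auto)
  also have "(\<lambda>x. h x * indicator S x) = (\<lambda>x. if x \<in> S then h x else 0)"
    by (auto split: split_indicator)
  finally show "(h has_integral b) S"
    by (simp add: has_integral_restrict_UNIV)
qed

text \<open>Change of variables for the constant function 1. For each finite \<open>b\<close>, one
  side equals \<open>b\<close> iff the other does; hence both sides are also infinite
  together.\<close>

lemma emeasure_image_inj_on:
  fixes g g' :: "real \<Rightarrow> real"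
  assumes [measurable]: "V \<in> sets borel" "g ` V \<in> sets borel" "g' \<in> borel_measurable borel"
    and der: "\<And>x. x \<in> V \<Longrightarrow> (g has_field_derivative g' x) (at x)"
    and inj: "inj_on g V"
  shows "emeasure lborel (g ` V) = (\<integral>\<^sup>+x\<in>V. ennreal \<bar>g' x\<bar> \<partial>lborel)"
proof -
  have iff: "((\<lambda>x. \<bar>g' x\<bar>) has_integral b) V \<longleftrightarrow> ((\<lambda>x. 1) has_integral b) (g ` V)" for b :: real
  proof -
    have "(\<lambda>x. \<bar>g' x\<bar> * 1) absolutely_integrable_on V \<and> integral V (\<lambda>x. \<bar>g' x\<bar> * 1) = b \<longleftrightarrow>
        (\<lambda>x. 1::real) absolutely_integrable_on g ` V \<and> integral (g ` V) (\<lambda>x. 1) = b"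
      using has_absolute_integral_change_of_variables_1'[of V g g' "\<lambda>_. 1" b] der inj
      by (auto intro: has_field_derivative_at_within)
    then show ?thesis
      by (simp add: absolutely_integrable_on_iff_nonneg has_integral_iff)
  qed
  have "emeasure lborel (g ` V) = ennreal b \<longleftrightarrow>
      (\<integral>\<^sup>+x\<in>V. ennreal \<bar>g' x\<bar> \<partial>lborel) = ennreal b" if "0 \<le> b" for b
    using iff[of b] that
    by (simp add: has_integral_iff_set_nn_integral has_integral_iff_emeasure_lborel)
  then show ?thesis
    by (metis ennreal_cases)
qed

lemma nn_integral_substitution_inj_on:
  fixes f :: "real \<Rightarrow> ennreal" and g g' :: "real \<Rightarrow> real"
  assumes [measurable]: "f \<in> borel_measurable borel" "U \<in> sets borel" "g ` U \<in> sets borel"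
      "g \<in> borel_measurable borel" "g' \<in> borel_measurable borel"
    and der: "\<And>x. x \<in> U \<Longrightarrow> (g has_field_derivative g' x) (at x)"
    and inj: "inj_on g U"
  shows "(\<integral>\<^sup>+x\<in>g ` U. f x \<partial>lborel) = (\<integral>\<^sup>+x\<in>U. ennreal \<bar>g' x\<bar> * f (g x) \<partial>lborel)"
proof -
  define M where "M = density lborel (indicator (g ` U) :: real \<Rightarrow> ennreal)"
  define N where "N = distr (density lborel (\<lambda>x. indicator U x * ennreal \<bar>g' x\<bar>)) borel g"
  have "M = N"
  proof (rule measure_eqI)
    fix A assume "A \<in> sets M"
    then have A[measurable]: "A \<in> sets borel" by (simp add: M_def)
    define V where "V = U \<inter> g -` A"
    have [measurable]: "V \<in> sets borel"
      using measurable_sets_borel[of g borel A] by (simp add: V_def)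
    have img: "g ` V = g ` U \<inter> A" by (auto simp: V_def)
    then have [measurable]: "g ` V \<in> sets borel" by simp
    have "emeasure M A = emeasure lborel (g ` V)"
      unfolding M_def img by (simp add: emeasure_density flip: indicator_inter_arith)
    also have "\<dots> = (\<integral>\<^sup>+x\<in>V. ennreal \<bar>g' x\<bar> \<partial>lborel)"
      by (rule emeasure_image_inj_on) (use der inj \<open>g ` V \<in> sets borel\<close> in \<open>auto simp: V_def inj_on_def\<close>)
    also have "\<dots> = emeasure N A"
      unfolding N_def V_def
      by (subst emeasure_distr; simp?; subst emeasure_density; simp?)
        (auto intro!: nn_integral_cong measurable_sets_borel[of g borel A] split: split_indicator)
    finally show "emeasure M A = emeasure N A" .
  qed (simp add: M_def N_def)
  then have "(\<integral>\<^sup>+x. f x \<partial>M) = (\<integral>\<^sup>+x. f x \<partial>N)" by simp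
  then show ?thesis
    unfolding M_def N_def
    by (simp add: nn_integral_density nn_integral_distr ac_simps)
qed

lemma nn_integral_periodic_shift:
  fixes h :: "real \<Rightarrow> ennreal"
  assumes [measurable]: "h \<in> borel_measurable borel" and T: "T > 0" and per: "\<And>t. h (t + T) = h t"
  shows "(\<integral>\<^sup>+t\<in>{0..<T}. h (a + t) \<partial>lborel) = (\<integral>\<^sup>+t\<in>{0..<T}. h t \<partial>lborel)"
proof -
  have per_nat: "h (t + real n * T) = h t" for t n
  proof (induction n arbitrary: t)
    case (Suc n)
    have "h (t + real (Suc n) * T) = h ((t + real n * T) + T)" by (simp add: algebra_simps)
    then show ?case by (simp add: per Suc)
  qed simp
  have per_int: "h (t + of_int k * T) = h t" for t k
  proof (cases "k \<ge> 0")
    case True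
    then show ?thesis using per_nat[of t "nat k"] by simp
  next
    case False
    then show ?thesis using per_nat[of "t + of_int k * T" "nat (- k)"] by simp
  qed
  define I where "I k = {of_int k * T..<of_int k * T + T}" for k :: int
  have mem: "t \<in> I k \<longleftrightarrow> k = \<lfloor>t / T\<rfloor>" for t k
    using T by (auto simp: I_def field_simps floor_eq_iff eq_commute[of k])
  have one: "(\<integral>\<^sup>+k. indicator (I k) t \<partial>count_space UNIV) = (1::ennreal)" for t
  proof -
    have "(\<integral>\<^sup>+k. indicator (I k) t \<partial>count_space UNIV) =
        (\<integral>\<^sup>+k. indicator {\<lfloor>t / T\<rfloor>} k \<partial>count_space UNIV)"
      by (rule nn_integral_cong) (auto simp: mem split: split_indicator)
    then show ?thesis by simp
  qed
  have [measurable]: "I k \<in> sets borel" for k by (simp add: I_def)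
  have insert: "(\<integral>\<^sup>+t. H t \<partial>lborel) = (\<integral>\<^sup>+k. \<integral>\<^sup>+t. H t * indicator (I k) t \<partial>lborel \<partial>count_space UNIV)"
    if [measurable]: "H \<in> borel_measurable borel" for H :: "real \<Rightarrow> ennreal"
  proof -
    have "(\<integral>\<^sup>+t. H t \<partial>lborel) = (\<integral>\<^sup>+t. \<integral>\<^sup>+k. H t * indicator (I k) t \<partial>count_space UNIV \<partial>lborel)"
      by (simp add: nn_integral_cmult one)
    also have "\<dots> = (\<integral>\<^sup>+k. \<integral>\<^sup>+t. H t * indicator (I k) t \<partial>lborel \<partial>count_space UNIV)"
      by (rule nn_integral_count_space_nn_integral) auto
    finally show ?thesis .
  qed
  have shift: "(\<integral>\<^sup>+t. H t \<partial>lborel) = (\<integral>\<^sup>+t. H (c + t) \<partial>lborel)"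
    if "H \<in> borel_measurable borel" for H :: "real \<Rightarrow> ennreal" and c :: real
    using nn_integral_real_affine[OF that, of 1 c] by simp
  have "(\<integral>\<^sup>+t\<in>{0..<T}. h (a + t) \<partial>lborel) = (\<integral>\<^sup>+t\<in>{a..<a + T}. h t \<partial>lborel)"
    by (subst shift[of "\<lambda>t. h t * indicator {a..<a + T} t" a])
      (auto intro!: nn_integral_cong split: split_indicator)
  also have "\<dots> = (\<integral>\<^sup>+k. \<integral>\<^sup>+t. h t * indicator {a..<a + T} t * indicator (I k) t \<partial>lborel \<partial>count_space UNIV)"
    by (rule insert) simp
  \<comment> \<open>The piece of \<open>{a..<a + T}\<close> in the tile \<open>I k\<close> is moved
    back by \<open>k * T\<close> into the base period, where it consists of the \<open>t\<close>
    with \<open>t - a \<in> I (- k)\<close>. Each \<open>t\<close> of the base period is hit by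
    exactly one \<open>k\<close>.\<close>
  also have "\<dots> = (\<integral>\<^sup>+k. \<integral>\<^sup>+t. h t * indicator {0..<T} t * indicator (I (- k)) (t - a) \<partial>lborel \<partial>count_space UNIV)"
  proof (rule nn_integral_cong)
    fix k :: int
    show "(\<integral>\<^sup>+t. h t * indicator {a..<a + T} t * indicator (I k) t \<partial>lborel) =
        (\<integral>\<^sup>+t. h t * indicator {0..<T} t * indicator (I (- k)) (t - a) \<partial>lborel)"
    proof (subst shift[of _ "of_int k * T"], simp, rule nn_integral_cong)
      fix t :: real
      have "h (of_int k * T + t) = h t"
        using per_int[of t k] by (simp add: add.commute)
      then show "h (of_int k * T + t) * indicator {a..<a + T} (of_int k * T + t) *
          indicator (I k) (of_int k * T + t) = h t * indicator {0..<T} t * indicator (I (- k)) (t - a)"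
        by (auto simp: I_def split: split_indicator)
    qed
  qed
  also have "\<dots> = (\<integral>\<^sup>+t. \<integral>\<^sup>+k. h t * indicator {0..<T} t * indicator (I (- k)) (t - a) \<partial>count_space UNIV \<partial>lborel)"
    by (rule nn_integral_count_space_nn_integral[symmetric]) auto
  also have "\<dots> = (\<integral>\<^sup>+t\<in>{0..<T}. h t \<partial>lborel)"
  proof (rule nn_integral_cong)
    fix t :: real
    have "(\<integral>\<^sup>+k. indicator (I (- k)) (t - a) \<partial>count_space UNIV) =
        (\<integral>\<^sup>+k. indicator {- \<lfloor>(t - a) / T\<rfloor>} k \<partial>count_space UNIV)"
      by (rule nn_integral_cong) (auto simp: mem split: split_indicator)
    then have "(\<integral>\<^sup>+k. indicator (I (- k)) (t - a) \<partial>count_space UNIV) = (1 :: ennreal)"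
      by simp
    then show "(\<integral>\<^sup>+k. h t * indicator {0..<T} t * indicator (I (- k)) (t - a) \<partial>count_space UNIV) =
        h t * indicator {0..<T} t"
      by (simp add: nn_integral_cmult)
  qed
  finally show ?thesis .
qed

section \<open>The hyperbolic measure\<close>

lemma borel_measurable_fst_snd [measurable (raw)]:
  fixes f :: "'a \<Rightarrow> 'b::second_countable_topology \<times> 'c::second_countable_topology"
  assumes "f \<in> borel_measurable M"
  shows "(\<lambda>x. fst (f x)) \<in> borel_measurable M" "(\<lambda>x. snd (f x)) \<in> borel_measurable M"
  using assms by (auto intro: measurable_fst' measurable_snd' simp: borel_prod[symmetric])

text \<open>\<open>dy / y\<close> is Haar measure on the multiplicative group of positive reals, so
  \<open>y \<mapsto> c / y\<close> preserves it.\<close>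

lemma nn_integral_inversion_dy_over_y:
  fixes k :: "real \<Rightarrow> ennreal"
  assumes [measurable]: "k \<in> borel_measurable borel" and c: "c > 0"
  shows "(\<integral>\<^sup>+y\<in>{0<..}. ennreal (1 / y) * k (c / y) \<partial>lborel) = (\<integral>\<^sup>+y\<in>{0<..}. ennreal (1 / y) * k y \<partial>lborel)"
proof -
  have img: "(\<lambda>y. c / y) ` {0<..} = {0<..}"
  proof (intro equalityI subsetI)
    fix y :: real assume "y \<in> {0<..}"
    then show "y \<in> (\<lambda>y. c / y) ` {0<..}" using c by (intro image_eqI[of _ _ "c / y"]) auto
  qed (use c in auto)
  have "(\<integral>\<^sup>+y\<in>(\<lambda>y. c / y) ` {0<..}. ennreal (1 / y) * k y \<partial>lborel) =
      (\<integral>\<^sup>+y\<in>{0<..}. ennreal \<bar>- c / y\<^sup>2\<bar> * (ennreal (1 / (c / y)) * k (c / y)) \<partial>lborel)"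
  proof (rule nn_integral_substitution_inj_on)
    show "((\<lambda>y. c / y) has_real_derivative - c / x\<^sup>2) (at x)" if "x \<in> {0<..}" for x
      using that by (auto intro!: derivative_eq_intros simp: power2_eq_square)
    show "inj_on (\<lambda>y. c / y) {0<..}"
      using c by (auto simp: inj_on_def field_simps)
  qed (auto simp: img)
  also have "\<dots> = (\<integral>\<^sup>+y\<in>{0<..}. ennreal (1 / y) * k (c / y) \<partial>lborel)"
  proof (rule nn_integral_cong)
    fix y :: real
    have "ennreal \<bar>- c / y\<^sup>2\<bar> * ennreal (1 / (c / y)) = ennreal (1 / y)" if "y > 0"
      using that c by (simp flip: ennreal_mult add: power2_eq_square field_simps)
    then show "ennreal \<bar>- c / y\<^sup>2\<bar> * (ennreal (1 / (c / y)) * k (c / y)) * indicator {0<..} y =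
        ennreal (1 / y) * k (c / y) * indicator {0<..} y"
      by (auto simp flip: mult.assoc split: split_indicator)
  qed
  finally show ?thesis by (simp add: img)
qed

lemma nn_integral_lborel_prod_iterated:
  fixes f :: "real \<times> real \<Rightarrow> ennreal"
  assumes [measurable]: "f \<in> borel_measurable borel"
  shows "(\<integral>\<^sup>+p. f p \<partial>lborel) = (\<integral>\<^sup>+y. \<integral>\<^sup>+x. f (x, y) \<partial>lborel \<partial>lborel)"
    and "(\<integral>\<^sup>+p. f p \<partial>lborel) = (\<integral>\<^sup>+x. \<integral>\<^sup>+y. f (x, y) \<partial>lborel \<partial>lborel)"
  using lborel_pair.nn_integral_snd[of f] lborel.nn_integral_fst[of f lborel]
  by (simp_all add: lborel_prod borel_prod)

text \<open>Hyperbolic area of the upper half-plane, kept as a measure on the whole plane so that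
  measurability is plain Borel measurability.\<close>

definition hyp_measure :: "(real \<times> real) measure" where
  "hyp_measure = density lborel (\<lambda>p. ennreal (indicator {0<..} (snd p) / (snd p)\<^sup>2))"

lemma sets_hyp_measure [measurable_cong, simp]: "sets hyp_measure = sets borel"
  by (simp add: hyp_measure_def)

lemma space_hyp_measure [simp]: "space hyp_measure = UNIV"
  by (simp add: hyp_measure_def)

lemma nn_integral_hyp_measure:
  assumes [measurable]: "h \<in> borel_measurable borel"
  shows "(\<integral>\<^sup>+p. h p \<partial>hyp_measure) =
    (\<integral>\<^sup>+y\<in>{0<..}. ennreal (1 / y\<^sup>2) * (\<integral>\<^sup>+x. h (x, y) \<partial>lborel) \<partial>lborel)"
proof -
  have "(\<integral>\<^sup>+p. h p \<partial>hyp_measure) =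
      (\<integral>\<^sup>+p. ennreal (indicator {0<..} (snd p) / (snd p)\<^sup>2) * h p \<partial>lborel)"
    unfolding hyp_measure_def by (rule nn_integral_density) auto
  also have "\<dots> = (\<integral>\<^sup>+y. \<integral>\<^sup>+x. ennreal (indicator {0<..} y / y\<^sup>2) * h (x, y) \<partial>lborel \<partial>lborel)"
    by (subst nn_integral_lborel_prod_iterated(1)) auto
  also have "\<dots> = (\<integral>\<^sup>+y\<in>{0<..}. ennreal (1 / y\<^sup>2) * (\<integral>\<^sup>+x. h (x, y) \<partial>lborel) \<partial>lborel)"
    by (auto intro!: nn_integral_cong simp: nn_integral_cmult split: split_indicator)
  finally show ?thesis .
qed

text \<open>Substitution \<open>x = s * y\<close> on each horizontal line. Dilations and the
  inversion act on the height alone in these coordinates, up to the sign of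
  \<open>s\<close>.\<close>

lemma nn_integral_hyp_measure_slope:
  assumes [measurable]: "h \<in> borel_measurable borel"
  shows "(\<integral>\<^sup>+p. h p \<partial>hyp_measure) =
    (\<integral>\<^sup>+s. (\<integral>\<^sup>+y\<in>{0<..}. ennreal (1 / y) * h (s * y, y) \<partial>lborel) \<partial>lborel)"
proof -
  have "(\<integral>\<^sup>+p. h p \<partial>hyp_measure) =
      (\<integral>\<^sup>+y\<in>{0<..}. (\<integral>\<^sup>+s. ennreal (1 / y) * h (s * y, y) \<partial>lborel) \<partial>lborel)"
    unfolding nn_integral_hyp_measure[OF assms]
  proof (rule nn_integral_cong)
    fix y :: real
    have "ennreal (1 / y\<^sup>2) * (\<integral>\<^sup>+x. h (x, y) \<partial>lborel) =
        (\<integral>\<^sup>+s. ennreal (1 / y) * h (s * y, y) \<partial>lborel)" if y: "y > 0"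
    proof -
      have "(\<integral>\<^sup>+x. h (x, y) \<partial>lborel) = ennreal y * (\<integral>\<^sup>+s. h (s * y, y) \<partial>lborel)"
        by (subst nn_integral_real_affine[of _ y 0]) (use y in \<open>simp_all add: mult.commute\<close>)
      moreover have "ennreal (1 / y\<^sup>2) * ennreal y = ennreal (1 / y)"
        using y by (simp flip: ennreal_mult add: power2_eq_square)
      ultimately show ?thesis
        by (simp add: nn_integral_cmult flip: mult.assoc)
    qed
    then show "ennreal (1 / y\<^sup>2) * (\<integral>\<^sup>+x. h (x, y) \<partial>lborel) * indicator {0<..} y =
        (\<integral>\<^sup>+s. ennreal (1 / y) * h (s * y, y) \<partial>lborel) * indicator {0<..} y"
      by (auto split: split_indicator)
  qed
  also have "\<dots> = (\<integral>\<^sup>+y. \<integral>\<^sup>+s. ennreal (1 / y) * h (s * y, y) * indicator {0<..} y \<partial>lborel \<partial>lborel)"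
    by (intro nn_integral_cong) (simp add: nn_integral_multc)
  also have "\<dots> = (\<integral>\<^sup>+s. (\<integral>\<^sup>+y\<in>{0<..}. ennreal (1 / y) * h (s * y, y) \<partial>lborel) \<partial>lborel)"
    by (rule lborel_pair.Fubini') measurable
  finally show ?thesis .
qed

lemma nn_integral_hyp_measure_translate:
  assumes [measurable]: "h \<in> borel_measurable borel"
  shows "(\<integral>\<^sup>+p. h (a + fst p, snd p) \<partial>hyp_measure) = (\<integral>\<^sup>+p. h p \<partial>hyp_measure)"
proof -
  have "(\<integral>\<^sup>+x. h (a + x, y) \<partial>lborel) = (\<integral>\<^sup>+x. h (x, y) \<partial>lborel)" for y
    using nn_integral_real_affine[of "\<lambda>x. h (x, y)" 1 a] by simp
  then show ?thesis by (simp add: nn_integral_hyp_measure)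
qed

lemma nn_integral_hyp_measure_scale:
  assumes [measurable]: "h \<in> borel_measurable borel" and c: "c > 0"
  shows "(\<integral>\<^sup>+p. h (c * fst p, c * snd p) \<partial>hyp_measure) = (\<integral>\<^sup>+p. h p \<partial>hyp_measure)"
proof -
  have "(\<integral>\<^sup>+p. h p \<partial>hyp_measure) =
      (\<integral>\<^sup>+s. ennreal c * (\<integral>\<^sup>+y. ennreal (1 / (c * y)) * h (s * (c * y), c * y) * indicator {0<..} (c * y) \<partial>lborel) \<partial>lborel)"
    unfolding nn_integral_hyp_measure_slope[OF assms(1)]
    by (intro nn_integral_cong, subst nn_integral_real_affine[of _ c 0]) (use c in simp_all)
  also have "\<dots> = (\<integral>\<^sup>+s. (\<integral>\<^sup>+y\<in>{0<..}. ennreal (1 / y) * h (c * (s * y), c * y) \<partial>lborel) \<partial>lborel)"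
  proof (intro nn_integral_cong, subst nn_integral_cmult[symmetric], simp, intro nn_integral_cong)
    fix s y :: real
    have "ennreal c * ennreal (1 / (c * y)) = ennreal (1 / y)" if "y > 0"
      using that c by (simp flip: ennreal_mult)
    then show "ennreal c * (ennreal (1 / (c * y)) * h (s * (c * y), c * y) * indicator {0<..} (c * y)) =
        ennreal (1 / y) * h (c * (s * y), c * y) * indicator {0<..} y"
      using c by (auto simp: zero_less_mult_iff mult.commute[of s c] simp flip: mult.assoc split: split_indicator)
  qed
  also have "\<dots> = (\<integral>\<^sup>+p. h (c * fst p, c * snd p) \<partial>hyp_measure)"
    by (subst nn_integral_hyp_measure_slope) simp_all
  finally show ?thesis ..
qed

text \<open>In the coordinates \<open>(s, y)\<close> with \<open>s = x / y\<close> the measure is \<open>ds dy / y\<close> and the inversion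
  \<open>\<tau> \<mapsto> -1 / \<tau>\<close> is \<open>(s, y) \<mapsto> (-s, 1 / ((s\<^sup>2 + 1) y))\<close>.\<close>
lemma nn_integral_hyp_measure_inversion:
  assumes [measurable]: "h \<in> borel_measurable borel"
  shows "(\<integral>\<^sup>+p. h (- fst p / ((fst p)\<^sup>2 + (snd p)\<^sup>2), snd p / ((fst p)\<^sup>2 + (snd p)\<^sup>2)) \<partial>hyp_measure) =
    (\<integral>\<^sup>+p. h p \<partial>hyp_measure)"
proof -
  have "(\<integral>\<^sup>+p. h (- fst p / ((fst p)\<^sup>2 + (snd p)\<^sup>2), snd p / ((fst p)\<^sup>2 + (snd p)\<^sup>2)) \<partial>hyp_measure) =
      (\<integral>\<^sup>+s. (\<integral>\<^sup>+y\<in>{0<..}. ennreal (1 / y) *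
         h (- (s * y) / ((s * y)\<^sup>2 + y\<^sup>2), y / ((s * y)\<^sup>2 + y\<^sup>2)) \<partial>lborel) \<partial>lborel)"
    by (subst nn_integral_hyp_measure_slope) simp_all
  also have "\<dots> = (\<integral>\<^sup>+s. (\<integral>\<^sup>+y\<in>{0<..}. ennreal (1 / y) *
         h (- s * (1 / (s\<^sup>2 + 1) / y), 1 / (s\<^sup>2 + 1) / y) \<partial>lborel) \<partial>lborel)"
  proof (intro nn_integral_cong)
    fix s y :: real
    have "(s * y)\<^sup>2 + y\<^sup>2 = y\<^sup>2 * (s\<^sup>2 + 1)" by (simp add: algebra_simps power2_eq_square)
    moreover have "s\<^sup>2 + 1 > 0" by (simp add: add_nonneg_pos)
    ultimately have "- (s * y) / ((s * y)\<^sup>2 + y\<^sup>2) = - s * (1 / (s\<^sup>2 + 1) / y)"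
        "y / ((s * y)\<^sup>2 + y\<^sup>2) = 1 / (s\<^sup>2 + 1) / y" if "y > 0"
      using that by (simp_all add: power2_eq_square)
    then show "ennreal (1 / y) * h (- (s * y) / ((s * y)\<^sup>2 + y\<^sup>2), y / ((s * y)\<^sup>2 + y\<^sup>2)) * indicator {0<..} y =
       ennreal (1 / y) * h (- s * (1 / (s\<^sup>2 + 1) / y), 1 / (s\<^sup>2 + 1) / y) * indicator {0<..} y"
      by (auto split: split_indicator)
  qed
  also have "\<dots> = (\<integral>\<^sup>+s. (\<integral>\<^sup>+y\<in>{0<..}. ennreal (1 / y) * h (- s * y, y) \<partial>lborel) \<partial>lborel)"
    by (intro nn_integral_cong nn_integral_inversion_dy_over_y) (simp_all add: add_nonneg_pos)
  also have "\<dots> = (\<integral>\<^sup>+s. (\<integral>\<^sup>+y\<in>{0<..}. ennreal (1 / y) * h (s * y, y) \<partial>lborel) \<partial>lborel)"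
    using nn_integral_real_affine[of "\<lambda>s. (\<integral>\<^sup>+y\<in>{0<..}. ennreal (1 / y) * h (s * y, y) \<partial>lborel)" "-1" 0]
    by simp
  also have "\<dots> = (\<integral>\<^sup>+p. h p \<partial>hyp_measure)"
    by (rule nn_integral_hyp_measure_slope[symmetric]) simp
  finally show ?thesis .
qed

section \<open>Invariance under Moebius transformations\<close>

text \<open>The image of \<open>\<tau> = x + i y\<close> under \<open>\<tau> \<mapsto> (p + q \<tau>) / (m + n \<tau>)\<close> for \<open>m q - n p = 1\<close>:
  this is the modulus of the lattice \<open>\<int> + \<tau> \<int>\<close> with respect to its basis
  \<open>(m + n \<tau>, p + q \<tau>)\<close>.\<close>
definition moebius :: "real \<times> real \<times> real \<times> real \<Rightarrow> real \<times> real \<Rightarrow> real \<times> real" where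
  "moebius = (\<lambda>(m, n, p, q) (x, y).
     (((p + q * x) * (m + n * x) + n * q * y\<^sup>2) / ((m + n * x)\<^sup>2 + (n * y)\<^sup>2),
      y / ((m + n * x)\<^sup>2 + (n * y)\<^sup>2)))"

lemma moebius_denom_pos:
  fixes m n p q x y :: real
  assumes "m * q - n * p = 1" "y \<noteq> 0"
  shows "(m + n * x)\<^sup>2 + (n * y)\<^sup>2 > 0"
  using assms by (cases "n = 0") (auto simp: sum_power2_gt_zero_iff)

text \<open>With \<open>\<tau>'\<close> the image of \<open>\<tau>\<close>, the determinant
  condition gives \<open>q - n \<tau>' = 1 / (m + n \<tau>)\<close> and
  \<open>m \<tau>' - p = \<tau> / (m + n \<tau>)\<close>, whose quotient is \<open>\<tau>\<close>.
  The facts \<open>a\<close> and \<open>b\<close> are the real parts of these identities.\<close>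

lemma moebius_inverse:
  assumes det: "m * q - n * p = 1" and y: "y \<noteq> 0"
  shows "moebius (q, - n, - p, m) (moebius (m, n, p, q) (x, y)) = (x, y)"
proof -
  define J where "J = (m + n * x)\<^sup>2 + (n * y)\<^sup>2"
  define C where "C = (p + q * x) * (m + n * x) + n * q * y\<^sup>2"
  have J: "J > 0" unfolding J_def using moebius_denom_pos[OF assms] .
  have "q * J - n * C = (m * q - n * p) * (m + n * x)"
    unfolding J_def C_def by algebra
  then have a: "q + - n * (C / J) = (m + n * x) / J"
    using J det by (simp add: field_simps)
  have "m * C - p * J = (m * q - n * p) * ((m + n * x) * x + n * y\<^sup>2)"
    unfolding J_def C_def by algebra
  then have b: "- p + m * (C / J) = ((m + n * x) * x + n * y\<^sup>2) / J"
    using J det by (simp add: field_simps)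
  have denom: "(q + - n * (C / J))\<^sup>2 + (- n * (y / J))\<^sup>2 = 1 / J"
  proof -
    have "(q + - n * (C / J))\<^sup>2 + (- n * (y / J))\<^sup>2 = J / J\<^sup>2"
      unfolding a by (simp add: power_divide J_def power_mult_distrib flip: add_divide_distrib)
    then show ?thesis using J by (simp add: power2_eq_square)
  qed
  have num: "(- p + m * (C / J)) * (q + - n * (C / J)) + - n * m * (y / J)\<^sup>2 = x / J"
  proof -
    have "((m + n * x) * x + n * y\<^sup>2) * (m + n * x) - n * m * y\<^sup>2 = x * J"
      unfolding J_def by algebra
    then have "(((m + n * x) * x + n * y\<^sup>2) * (m + n * x) - n * m * y\<^sup>2) / J\<^sup>2 = x / J"
      using J by (simp add: power2_eq_square)
    then show ?thesis
      unfolding a b by (simp add: power2_eq_square diff_divide_distrib)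
  qed
  have "moebius (m, n, p, q) (x, y) = (C / J, y / J)"
    by (simp add: moebius_def C_def J_def)
  then show ?thesis
    using J by (simp only: moebius_def prod.case denom num) simp
qed

lemma borel_measurable_moebius [measurable]: "moebius g \<in> borel_measurable borel"
  by (cases g) (simp add: moebius_def split_beta')

lemma AE_hyp_measure_pos: "AE z in hyp_measure. snd z > 0"
  unfolding hyp_measure_def by (subst AE_density) (auto split: split_indicator)

text \<open>Bruhat decomposition: for \<open>n = 0\<close> the map is a dilation followed by a
  translation; otherwise \<open>(p + q \<tau>) / (m + n \<tau>) = q / n + (1 / n\<^sup>2) * (- 1 /
  (\<tau> + m / n))\<close>, a composition of translations, the inversion and a dilation.\<close>

lemma nn_integral_hyp_measure_moebius:
  assumes [measurable]: "h \<in> borel_measurable borel" and det: "m * q - n * p = 1"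
  shows "(\<integral>\<^sup>+z. h (moebius (m, n, p, q) z) \<partial>hyp_measure) = (\<integral>\<^sup>+z. h z \<partial>hyp_measure)"
proof (cases "n = 0")
  case True
  then have m: "m \<noteq> 0" using det by auto
  then have q: "q = 1 / m" using det True by (simp add: field_simps)
  have "(\<integral>\<^sup>+z. h (moebius (m, n, p, q) z) \<partial>hyp_measure) =
      (\<integral>\<^sup>+z. h (p / m + fst (1 / m\<^sup>2 * fst z, 1 / m\<^sup>2 * snd z), snd (1 / m\<^sup>2 * fst z, 1 / m\<^sup>2 * snd z)) \<partial>hyp_measure)"
    using m by (intro nn_integral_cong)
      (simp add: moebius_def split_beta True q power2_eq_square field_simps)
  also have "\<dots> = (\<integral>\<^sup>+z. h (p / m + fst z, snd z) \<partial>hyp_measure)"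
    by (rule nn_integral_hyp_measure_scale) (use m in simp_all)
  also have "\<dots> = (\<integral>\<^sup>+z. h z \<partial>hyp_measure)"
    by (rule nn_integral_hyp_measure_translate) simp
  finally show ?thesis .
next
  case n: False
  define h1 where "h1 z = h (q / n + fst z, snd z)" for z
  define h2 where "h2 z = h1 (1 / n\<^sup>2 * fst z, 1 / n\<^sup>2 * snd z)" for z
  define h3 where "h3 z = h2 (- fst z / ((fst z)\<^sup>2 + (snd z)\<^sup>2), snd z / ((fst z)\<^sup>2 + (snd z)\<^sup>2))" for z
  have [measurable]: "h1 \<in> borel_measurable borel" unfolding h1_def by measurable
  have [measurable]: "h2 \<in> borel_measurable borel" unfolding h2_def by measurable
  have [measurable]: "h3 \<in> borel_measurable borel" unfolding h3_def by measurable
  have "(\<integral>\<^sup>+z. h (moebius (m, n, p, q) z) \<partial>hyp_measure) =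
      (\<integral>\<^sup>+z. h3 (m / n + fst z, snd z) \<partial>hyp_measure)"
  proof (rule nn_integral_cong_AE, rule AE_mp[OF AE_hyp_measure_pos], rule AE_I2, rule impI)
    fix z :: "real \<times> real" assume z: "snd z > 0"
    obtain x y where xy: "z = (x, y)" by (cases z)
    define X where "X = m / n + x"
    define R where "R = X\<^sup>2 + y\<^sup>2"
    have R: "R > 0" using z by (auto simp: xy R_def intro: add_nonneg_pos)
    have X: "m + n * x = n * X" using n by (simp add: X_def field_simps)
    have "n * (p + q * x) = q * (m + n * x) - (m * q - n * p)" by algebra
    then have pq: "p + q * x = q * X - 1 / n"
      using n det by (simp add: X field_simps)
    have J: "(m + n * x)\<^sup>2 + (n * y)\<^sup>2 = n\<^sup>2 * R"
      by (simp add: X R_def power_mult_distrib distrib_left)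
    have C: "(p + q * x) * (m + n * x) + n * q * y\<^sup>2 = n * q * R - X"
      using n by (simp add: X pq R_def field_simps power2_eq_square)
    have "moebius (m, n, p, q) z = ((n * q * R - X) / (n\<^sup>2 * R), y / (n\<^sup>2 * R))"
      by (simp add: moebius_def xy J C)
    also have "\<dots> = (q / n + 1 / n\<^sup>2 * (- X / R), 1 / n\<^sup>2 * (y / R))"
      using n R by (simp add: field_simps power2_eq_square)
    finally show "h (moebius (m, n, p, q) z) = h3 (m / n + fst z, snd z)"
      by (simp add: h3_def h2_def h1_def xy flip: X_def R_def)
  qed
  also have "\<dots> = (\<integral>\<^sup>+z. h3 z \<partial>hyp_measure)"
    by (rule nn_integral_hyp_measure_translate) simp
  also have "\<dots> = (\<integral>\<^sup>+z. h2 z \<partial>hyp_measure)"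
    unfolding h3_def by (rule nn_integral_hyp_measure_inversion) simp
  also have "\<dots> = (\<integral>\<^sup>+z. h1 z \<partial>hyp_measure)"
    unfolding h2_def by (rule nn_integral_hyp_measure_scale) (use n in simp_all)
  also have "\<dots> = (\<integral>\<^sup>+z. h z \<partial>hyp_measure)"
    unfolding h1_def by (rule nn_integral_hyp_measure_translate) simp
  finally show ?thesis .
qed

section \<open>The modular group and its fundamental domain\<close>

text \<open>The rows \<open>(m, n)\<close> and \<open>(p, q)\<close> are the coordinates of two
  lattice vectors, so the elements are the positive bases of a lattice with a given basis.\<close>

definition SL2Z :: "(int \<times> int \<times> int \<times> int) set" where
  "SL2Z = {(m, n, p, q). m * q - n * p = 1}"

definition sl2_act :: "int \<times> int \<times> int \<times> int \<Rightarrow> real \<times> real \<Rightarrow> real \<times> real" where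
  "sl2_act = (\<lambda>(m, n, p, q). moebius (of_int m, of_int n, of_int p, of_int q))"

text \<open>For \<open>\<tau> = x + i y\<close>, \<open>A = m + n \<tau>\<close> and \<open>B = p + q \<tau>\<close>, \<open>qform\<close> is \<open>|A|\<^sup>2\<close> and
  \<open>bform\<close> is the real part of the product of \<open>B\<close> with the conjugate of \<open>A\<close>.\<close>
definition qform :: "real \<Rightarrow> real \<Rightarrow> int \<Rightarrow> int \<Rightarrow> real" where
  "qform x y m n = (of_int m + of_int n * x)\<^sup>2 + (of_int n * y)\<^sup>2"

definition bform :: "real \<Rightarrow> real \<Rightarrow> int \<Rightarrow> int \<Rightarrow> int \<Rightarrow> int \<Rightarrow> real" where
  "bform x y m n p q = (of_int p + of_int q * x) * (of_int m + of_int n * x) + of_int n * of_int q * y\<^sup>2"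

definition modular_domain :: "(real \<times> real) set" where
  "modular_domain = {(x, y). \<bar>x\<bar> \<le> 1/2 \<and> x\<^sup>2 + y\<^sup>2 \<ge> 1 \<and> 0 < y}"

text \<open>A null set that contains the boundary of \<open>modular_domain\<close>. Away from its
  preimages under the group, all reduction inequalities are strict.\<close>

definition modular_walls :: "(real \<times> real) set" where
  "modular_walls = {(x, y). \<bar>x\<bar> = 1/2 \<or> x\<^sup>2 + y\<^sup>2 = 1}"

lemma real_det_SL2Z: "(m, n, p, q) \<in> SL2Z \<Longrightarrow> real_of_int m * real_of_int q - real_of_int n * real_of_int p = 1"
  unfolding SL2Z_def by (simp flip: of_int_mult of_int_diff)

text \<open>A disc contains finitely many lattice points: the imaginary part of
  \<open>m + n \<tau>\<close> bounds \<open>n\<close>, then the real part bounds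
  \<open>m\<close>.\<close>

lemma finite_qform_le:
  assumes y: "y \<noteq> 0"
  shows "finite {(m, n). qform x y m n \<le> R}"
proof -
  define K where "K = \<lceil>sqrt R / \<bar>y\<bar>\<rceil>"
  define L where "L = \<lceil>sqrt R + of_int K * \<bar>x\<bar>\<rceil>"
  have "{(m, n). qform x y m n \<le> R} \<subseteq> {- L..L} \<times> {- K..K}"
  proof clarify
    fix m n assume le: "qform x y m n \<le> R"
    have "(of_int n * y)\<^sup>2 \<le> R" "(of_int m + of_int n * x)\<^sup>2 \<le> R"
      using le unfolding qform_def by (smt (verit) zero_le_power2)+
    then have n: "\<bar>of_int n * y\<bar> \<le> sqrt R" and m: "\<bar>of_int m + of_int n * x\<bar> \<le> sqrt R"
      by (metis real_sqrt_abs real_sqrt_le_iff)+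
    have "real_of_int \<bar>n\<bar> \<le> sqrt R / \<bar>y\<bar>"
      using n y by (simp add: abs_mult field_simps)
    then have nK: "\<bar>n\<bar> \<le> K" unfolding K_def by linarith
    have "\<bar>of_int n * x\<bar> \<le> of_int K * \<bar>x\<bar>"
      unfolding abs_mult using nK by (intro mult_right_mono) (auto simp flip: of_int_abs)
    then have "real_of_int \<bar>m\<bar> \<le> sqrt R + of_int K * \<bar>x\<bar>"
      using m by linarith
    then have "\<bar>m\<bar> \<le> L" unfolding L_def by linarith
    with nK show "m \<in> {- L..L} \<and> n \<in> {- K..K}" by auto
  qed
  then show ?thesis by (rule finite_subset) auto
qed

text \<open>\<open>|A|\<^sup>2 |B|\<^sup>2\<close> is the sum of the squares of the real and the
  imaginary part of \<open>B\<close> times the conjugate of \<open>A\<close>; the imaginary part is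
  the determinant times \<open>y\<close>.\<close>

lemma qform_mult_eq:
  assumes "(m, n, p, q) \<in> SL2Z"
  shows "qform x y m n * qform x y p q = (bform x y m n p q)\<^sup>2 + y\<^sup>2"
proof -
  have "qform x y m n * qform x y p q = (bform x y m n p q)\<^sup>2 +
      (real_of_int m * real_of_int q - real_of_int n * real_of_int p)\<^sup>2 * y\<^sup>2"
    unfolding qform_def bform_def by algebra
  then show ?thesis by (simp add: real_det_SL2Z[OF assms])
qed

lemma sl2_act_eq:
  "sl2_act (m, n, p, q) (x, y) = (bform x y m n p q / qform x y m n, y / qform x y m n)"
  by (simp add: sl2_act_def moebius_def bform_def qform_def)

lemma qform_pos:
  assumes "(m, n, p, q) \<in> SL2Z" "y \<noteq> 0"
  shows "qform x y m n > 0"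
  unfolding qform_def using moebius_denom_pos[OF real_det_SL2Z[OF assms(1)] assms(2)] .

lemma norm_sl2_act:
  assumes "(m, n, p, q) \<in> SL2Z" "y \<noteq> 0"
  shows "(bform x y m n p q / qform x y m n)\<^sup>2 + (y / qform x y m n)\<^sup>2 = qform x y p q / qform x y m n"
proof -
  have "(bform x y m n p q / qform x y m n)\<^sup>2 + (y / qform x y m n)\<^sup>2 =
      (qform x y m n * qform x y p q) / (qform x y m n)\<^sup>2"
    by (simp add: power_divide qform_mult_eq[OF assms(1)] add_divide_distrib)
  then show ?thesis using qform_pos[OF assms] by (simp add: power2_eq_square)
qed

text \<open>Lying in the fundamental domain is Lagrange-Gauss reduction of the basis
  \<open>(A, B)\<close>: \<open>A\<close> is not longer than \<open>B\<close>, and the projection of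
  \<open>B\<close> to the line of \<open>A\<close> has at most half the length of
  \<open>A\<close>.\<close>

lemma sl2_act_in_domain_iff:
  assumes "(m, n, p, q) \<in> SL2Z" "y > 0"
  shows "sl2_act (m, n, p, q) (x, y) \<in> modular_domain \<longleftrightarrow>
    2 * \<bar>bform x y m n p q\<bar> \<le> qform x y m n \<and> qform x y m n \<le> qform x y p q"
  using qform_pos[of m n p q y x] assms(2) norm_sl2_act[OF assms(1), of y x] assms(1)
  unfolding sl2_act_eq modular_domain_def mem_Collect_eq prod.case by (simp add: le_divide_eq divide_le_eq mult.commute)

lemma sl2_act_in_walls_iff:
  assumes "(m, n, p, q) \<in> SL2Z" "y > 0"
  shows "sl2_act (m, n, p, q) (x, y) \<in> modular_walls \<longleftrightarrow>
    2 * \<bar>bform x y m n p q\<bar> = qform x y m n \<or> qform x y m n = qform x y p q"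
  using qform_pos[of m n p q y x] assms(2) norm_sl2_act[OF assms(1), of y x] assms(1)
  unfolding sl2_act_eq modular_walls_def mem_Collect_eq prod.case by (auto simp add: divide_eq_eq)

lemma coprime_imp_SL2Z:
  assumes "coprime m (n::int)"
  obtains p q where "(m, n, p, q) \<in> SL2Z"
proof -
  obtain u v where "u * m + v * n = 1"
    using bezout_int[of m n] assms by auto
  then have "(m, n, - v, u) \<in> SL2Z" by (simp add: SL2Z_def algebra_simps)
  then show thesis by (rule that)
qed

lemma SL2Z_coprime:
  assumes "(m, n, p, q) \<in> SL2Z"
  shows "coprime m n" "coprime p q"
proof -
  have "d dvd 1" if "d dvd m \<and> d dvd n \<or> d dvd p \<and> d dvd q" for d
  proof -
    have "d dvd m * q - n * p" using that by auto
    then show ?thesis using assms by (simp add: SL2Z_def)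
  qed
  then show "coprime m n" "coprime p q" by (auto intro: coprimeI)
qed

lemma SL2Z_shear:
  assumes "(m, n, p, q) \<in> SL2Z"
  shows "(m, n, p + k * m, q + k * n) \<in> SL2Z"
    and "bform x y m n (p + k * m) (q + k * n) = bform x y m n p q + of_int k * qform x y m n"
  using assms by (auto simp: SL2Z_def bform_def qform_def algebra_simps power2_eq_square)

text \<open>Gauss reduction: a shortest primitive vector is completed to a basis, and the second
  vector is sheared by the multiple of the first that makes its projection as short as
  possible.\<close>

lemma exists_sl2_act_in_domain:
  assumes y: "y > 0"
  shows "\<exists>g\<in>SL2Z. sl2_act g (x, y) \<in> modular_domain"
proof -
  \<comment> \<open>The bound 1 is the value at \<open>(1, 0)\<close>, so \<open>N\<close> is
    nonempty; a minimum over the finite set \<open>N\<close> is one over all coprime pairs.\<close>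
  define N where "N = {(m, n). coprime m n \<and> qform x y m n \<le> 1}"
  have "finite N"
    by (rule finite_subset[OF _ finite_qform_le[of y x 1]]) (use y in \<open>auto simp: N_def\<close>)
  moreover have "(1, 0) \<in> N" by (simp add: N_def qform_def)
  ultimately obtain mn where mn: "mn \<in> N" and min: "\<And>c. c \<in> N \<Longrightarrow> case_prod (qform x y) mn \<le> case_prod (qform x y) c"
    using arg_min_if_finite(1)[of N "case_prod (qform x y)"] arg_min_least[of N _ "case_prod (qform x y)"]
    by (metis empty_iff)
  obtain m n where [simp]: "mn = (m, n)" by (cases mn)
  have cop: "coprime m n" and le1: "qform x y m n \<le> 1" using mn by (auto simp: N_def)
  have min': "qform x y m n \<le> qform x y a b" if "coprime a b" for a b
    using min[of "(a, b)"] that le1 by (cases "(a, b) \<in> N") (auto simp: N_def)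
  obtain p q where pq: "(m, n, p, q) \<in> SL2Z" using coprime_imp_SL2Z[OF cop] .
  define k where "k = - round (bform x y m n p q / qform x y m n)"
  have Q: "qform x y m n > 0" using qform_pos[OF pq] y by simp
  note g = SL2Z_shear(1)[OF pq, of k]
  have "\<bar>bform x y m n p q / qform x y m n + of_int k\<bar> \<le> 1 / 2"
    unfolding k_def using of_int_round_abs_le[of "bform x y m n p q / qform x y m n"] by linarith
  then have "2 * \<bar>bform x y m n p q + of_int k * qform x y m n\<bar> \<le> qform x y m n"
    using Q by (simp add: abs_le_iff field_simps)
  then have "sl2_act (m, n, p + k * m, q + k * n) (x, y) \<in> modular_domain"
    unfolding sl2_act_in_domain_iff[OF g y] SL2Z_shear(2)[OF pq]
    using min' SL2Z_coprime(2)[OF g] by blast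
  with g show ?thesis by blast
qed

text \<open>If the new first vector has coordinates \<open>(k, l)\<close> in the strictly reduced
  basis and \<open>l \<noteq> 0\<close>, its squared length exceeds
  \<open>(k\<^sup>2 - \<bar>k * l\<bar> + l\<^sup>2) * Q \<ge> Q\<close>, against \<open>le\<close>.
  So \<open>l = 0\<close>, the first vectors agree up to sign, and the second ones can differ only
  by a shear.\<close>

lemma sl2_act_in_domain_unique_aux:
  assumes g: "(m, n, p, q) \<in> SL2Z" and g': "(m', n', p', q') \<in> SL2Z" and y: "y > 0"
    and red: "2 * \<bar>bform x y m n p q\<bar> < qform x y m n" "qform x y m n < qform x y p q"
    and red': "2 * \<bar>bform x y m' n' p' q'\<bar> < qform x y m' n'"
    and le: "qform x y m' n' \<le> qform x y m n"
  shows "(m', n', p', q') = (m, n, p, q) \<or> (m', n', p', q') = (- m, - n, - p, - q)"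
proof -
  have det: "m * q - n * p = 1" and det': "m' * q' - n' * p' = 1"
    using g g' by (auto simp: SL2Z_def)
  define k where "k = m' * q - n' * p"
  define l where "l = m * n' - n * m'"
  have m': "m' = k * m + l * p" and n': "n' = k * n + l * q"
    using det unfolding k_def l_def by algebra+
  define Q where "Q = qform x y m n"
  define C where "C = bform x y m n p q"
  define P where "P = qform x y p q"
  have Q: "Q > 0" unfolding Q_def using qform_pos[OF g] y by simp
  have "l = 0"
  proof (rule ccontr)
    assume l: "l \<noteq> 0"
    have exp: "qform x y m' n' = (of_int k)\<^sup>2 * Q + 2 * of_int k * of_int l * C + (of_int l)\<^sup>2 * P"
      unfolding m' n' Q_def C_def P_def qform_def bform_def of_int_add of_int_mult by algebra
    have "\<bar>2 * of_int k * of_int l * C\<bar> = \<bar>of_int (k * l)\<bar> * (2 * \<bar>C\<bar>)"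
      by (simp add: abs_mult)
    also have "\<dots> \<le> \<bar>of_int (k * l)\<bar> * Q"
      using red by (intro mult_left_mono) (auto simp: C_def Q_def)
    finally have 1: "2 * of_int k * of_int l * C \<ge> - (of_int \<bar>k * l\<bar> * Q)"
      by (simp add: abs_le_iff)
    have 2: "(of_int l)\<^sup>2 * P > (of_int l)\<^sup>2 * Q"
      using red l by (auto simp: P_def Q_def)
    have "k\<^sup>2 - \<bar>k * l\<bar> + l\<^sup>2 \<ge> 1"
    proof -
      have "2 * (k\<^sup>2 - \<bar>k * l\<bar> + l\<^sup>2) = (\<bar>k\<bar> - \<bar>l\<bar>)\<^sup>2 + k\<^sup>2 + l\<^sup>2"
        by (simp add: power2_eq_square algebra_simps abs_mult)
      moreover have "l\<^sup>2 > 0" using l by simp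
      moreover have "(\<bar>k\<bar> - \<bar>l\<bar>)\<^sup>2 \<ge> 0" "k\<^sup>2 \<ge> 0" by simp_all
      ultimately have "0 < 2 * (k\<^sup>2 - \<bar>k * l\<bar> + l\<^sup>2)" by linarith
      then show ?thesis by simp
    qed
    then have "real_of_int (k\<^sup>2 - \<bar>k * l\<bar> + l\<^sup>2) * Q \<ge> 1 * Q"
      using Q by (intro mult_right_mono) (simp_all only: of_int_1_le_iff less_imp_le)
    then have "(of_int k)\<^sup>2 * Q - of_int \<bar>k * l\<bar> * Q + (of_int l)\<^sup>2 * Q \<ge> Q"
      by (simp add: algebra_simps)
    with exp 1 2 le show False unfolding Q_def[symmetric] by linarith
  qed
  then have mn': "m' = k * m" "n' = k * n" using m' n' by simp_all
  have "k * (m * q' - n * p') = 1" using det' unfolding mn' by algebra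
  then have k: "k = 1 \<or> k = - 1" by (metis zmult_eq_1_iff)
  define a where "a = p' * q - q' * p"
  define b where "b = m * q' - n * p'"
  have "b = k" using \<open>k * (m * q' - n * p') = 1\<close> k by (auto simp: b_def)
  have "p' = a * m + b * p" "q' = a * n + b * q"
    using det unfolding a_def b_def by algebra+
  then have pq': "p' = a * m + k * p" "q' = a * n + k * q" by (simp_all add: \<open>b = k\<close>)
  have kk: "real_of_int k * real_of_int k = 1" using k by auto
  have "bform x y m' n' p' q' = of_int k * of_int a * Q + (of_int k * of_int k) * C"
    unfolding mn' pq' Q_def C_def qform_def bform_def of_int_add of_int_mult by algebra
  moreover have "qform x y m' n' = (of_int k * of_int k) * Q"
    unfolding mn' Q_def qform_def of_int_mult by algebra
  ultimately have "2 * \<bar>of_int (k * a) * Q + C\<bar> < Q" using red' kk by simp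
  moreover have "2 * \<bar>C\<bar> < Q" using red by (simp add: C_def Q_def)
  \<comment> \<open>Two numbers smaller than \<open>Q / 2\<close> in size differ by less than
    \<open>Q\<close>. Here the difference is the integer multiple \<open>k * a\<close> of
    \<open>Q\<close>, so it vanishes.\<close>
  moreover have "\<bar>u\<bar> < Q" if "2 * \<bar>u + C\<bar> < Q" "2 * \<bar>C\<bar> < Q" for u
    using that abs_triangle_ineq4[of "u + C" C] by simp
  ultimately have "\<bar>of_int (k * a) * Q\<bar> < Q" by blast
  then have "\<bar>real_of_int (k * a)\<bar> < 1" using Q by (simp add: abs_mult)
  then have "a = 0" using k by auto
  then show ?thesis using k mn' pq' by auto
qed

text \<open>The two elements are a reduced basis and its negative, which act alike. Off the walls
  every reduced basis is strictly reduced, so either of two reduced bases may take the part of the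
  one with the longer first vector in the uniqueness argument.\<close>

lemma card_sl2_act_in_domain:
  assumes y: "y > 0" and walls: "\<And>g. g \<in> SL2Z \<Longrightarrow> sl2_act g (x, y) \<notin> modular_walls"
  shows "card {g \<in> SL2Z. sl2_act g (x, y) \<in> modular_domain} = 2"
proof -
  have strict: "2 * \<bar>bform x y m n p q\<bar> < qform x y m n \<and> qform x y m n < qform x y p q"
    if "(m, n, p, q) \<in> SL2Z" "sl2_act (m, n, p, q) (x, y) \<in> modular_domain" for m n p q
    using that walls[OF that(1)] y by (auto simp: sl2_act_in_domain_iff sl2_act_in_walls_iff)
  obtain m n p q where g: "(m, n, p, q) \<in> SL2Z" and gD: "sl2_act (m, n, p, q) (x, y) \<in> modular_domain"
    using exists_sl2_act_in_domain[OF y, of x] by (metis prod_cases4)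
  have neg: "(- m, - n, - p, - q) \<in> SL2Z" using g by (auto simp: SL2Z_def)
  have negD: "sl2_act (- m, - n, - p, - q) (x, y) = sl2_act (m, n, p, q) (x, y)"
    by (simp add: sl2_act_def moebius_def power2_eq_square algebra_simps)
  have "{g \<in> SL2Z. sl2_act g (x, y) \<in> modular_domain} = {(m, n, p, q), (- m, - n, - p, - q)}"
  proof (intro equalityI subsetI)
    fix g' assume "g' \<in> {g \<in> SL2Z. sl2_act g (x, y) \<in> modular_domain}"
    moreover obtain m' n' p' q' where [simp]: "g' = (m', n', p', q')" by (metis prod_cases4)
    ultimately have g': "(m', n', p', q') \<in> SL2Z" "sl2_act (m', n', p', q') (x, y) \<in> modular_domain"
      by auto
    consider "qform x y m' n' \<le> qform x y m n" | "qform x y m n \<le> qform x y m' n'" by linarith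
    then show "g' \<in> {(m, n, p, q), (- m, - n, - p, - q)}"
    proof cases
      case 1
      then show ?thesis
        using sl2_act_in_domain_unique_aux[OF g g'(1) y, of x] strict[OF g gD] strict[OF g'] by auto
    next
      case 2
      then show ?thesis
        using sl2_act_in_domain_unique_aux[OF g'(1) g y, of x] strict[OF g gD] strict[OF g'] by auto
    qed
  qed (use g gD neg negD in auto)
  moreover have "(m, n, p, q) \<noteq> (- m, - n, - p, - q)" using g by (auto simp: SL2Z_def)
  ultimately show ?thesis by simp
qed

section \<open>Unfolding\<close>

lemma borel_measurable_sl2_act [measurable]: "sl2_act g \<in> borel_measurable borel"
  by (cases g) (simp add: sl2_act_def)

lemma borel_measurable_modular_domain [measurable]: "modular_domain \<in> sets borel"
proof -
  have "{z::real \<times> real. \<bar>fst z\<bar> \<le> 1/2 \<and> (fst z)\<^sup>2 + (snd z)\<^sup>2 \<ge> 1 \<and> 0 < snd z} \<in> sets borel"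
    by measurable
  then show ?thesis by (simp add: modular_domain_def case_prod_beta')
qed

lemma borel_measurable_modular_walls [measurable]: "modular_walls \<in> sets borel"
proof -
  have "{z::real \<times> real. \<bar>fst z\<bar> = 1/2 \<or> (fst z)\<^sup>2 + (snd z)\<^sup>2 = 1} \<in> sets borel"
    by measurable
  then show ?thesis by (simp add: modular_walls_def case_prod_beta')
qed

lemma nn_integral_hyp_measure_sl2_act:
  assumes "h \<in> borel_measurable borel" "g \<in> SL2Z"
  shows "(\<integral>\<^sup>+z. h (sl2_act g z) \<partial>hyp_measure) = (\<integral>\<^sup>+z. h z \<partial>hyp_measure)"
  using assms by (cases g) (auto simp: sl2_act_def intro!: nn_integral_hyp_measure_moebius real_det_SL2Z)

text \<open>Every horizontal line meets the walls in at most four points.\<close>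

lemma emeasure_modular_walls: "emeasure hyp_measure modular_walls = 0"
proof -
  have "(\<integral>\<^sup>+x. indicator modular_walls (x, y) \<partial>lborel) = 0" for y
  proof -
    have "{x. (x, y) \<in> modular_walls} \<subseteq> {1/2, -1/2, sqrt (1 - y\<^sup>2), - sqrt (1 - y\<^sup>2)}"
    proof
      fix x assume "x \<in> {x. (x, y) \<in> modular_walls}"
      then have "\<bar>x\<bar> = 1/2 \<or> x\<^sup>2 = 1 - y\<^sup>2" by (auto simp: modular_walls_def)
      then have "\<bar>x\<bar> = 1/2 \<or> \<bar>x\<bar> = sqrt (1 - y\<^sup>2)" by (metis real_sqrt_abs)
      then show "x \<in> {1/2, -1/2, sqrt (1 - y\<^sup>2), - sqrt (1 - y\<^sup>2)}" by auto
    qed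
    then have "{x. (x, y) \<in> modular_walls} \<in> null_sets lborel"
      by (intro finite_imp_null_set_lborel) (rule finite_subset, auto)
    then have "(\<integral>\<^sup>+x. indicator {x. (x, y) \<in> modular_walls} x \<partial>lborel) = 0"
      by (subst nn_integral_indicator) auto
    then show ?thesis by (simp add: indicator_def)
  qed
  then have "(\<integral>\<^sup>+z. indicator modular_walls z \<partial>hyp_measure) = 0"
    by (subst nn_integral_hyp_measure) simp_all
  then show ?thesis by simp
qed

lemma countable_SL2Z: "countable SL2Z"
  by (rule countableI_type)

text \<open>By invariance of the measure the preimage of the walls under each \<open>g\<close> is
  null, and the group is countable.\<close>

lemma AE_sl2_act_notin_walls: "AE z in hyp_measure. \<forall>g\<in>SL2Z. sl2_act g z \<notin> modular_walls"
proof (subst AE_ball_countable[OF countable_SL2Z], rule ballI)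
  fix g assume "g \<in> SL2Z"
  then have "(\<integral>\<^sup>+z. indicator modular_walls (sl2_act g z) \<partial>hyp_measure) = 0"
    by (subst nn_integral_hyp_measure_sl2_act) (simp_all add: emeasure_modular_walls)
  then show "AE z in hyp_measure. sl2_act g z \<notin> modular_walls"
    by (subst (asm) nn_integral_0_iff_AE) (auto split: split_indicator_asm)
qed

definition sl2_inv :: "int \<times> int \<times> int \<times> int \<Rightarrow> int \<times> int \<times> int \<times> int" where
  "sl2_inv = (\<lambda>(m, n, p, q). (q, - n, - p, m))"

lemma bij_betw_sl2_inv: "bij_betw sl2_inv SL2Z SL2Z"
  by (rule bij_betwI[where g = sl2_inv]) (auto simp: sl2_inv_def SL2Z_def algebra_simps)

lemma sl2_act_inverse:
  assumes "g \<in> SL2Z" "snd z > 0"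
  shows "sl2_act (sl2_inv g) (sl2_act g z) = z"
  using assms moebius_inverse[OF real_det_SL2Z] by (cases g; cases z) (auto simp: sl2_act_def sl2_inv_def)

text \<open>After exchanging sum and integral, invariance moves \<open>g\<close> from
  \<open>\<Psi>\<close> to the domain, and \<open>g\<close> is replaced by its inverse in the sum.
  Almost every point is then counted twice, by the pair \<open>g\<close>, \<open>- g\<close> that
  carries it into the domain.\<close>

theorem nn_integral_modular_unfolding:
  assumes [measurable]: "\<Psi> \<in> borel_measurable borel"
  shows "(\<integral>\<^sup>+z\<in>modular_domain. (\<integral>\<^sup>+g. \<Psi> (sl2_act g z) \<partial>count_space SL2Z) \<partial>hyp_measure) =
    2 * (\<integral>\<^sup>+z. \<Psi> z \<partial>hyp_measure)"
proof -
  have "(\<integral>\<^sup>+z\<in>modular_domain. (\<integral>\<^sup>+g. \<Psi> (sl2_act g z) \<partial>count_space SL2Z) \<partial>hyp_measure) =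
      (\<integral>\<^sup>+z. \<integral>\<^sup>+g. \<Psi> (sl2_act g z) * indicator modular_domain z \<partial>count_space SL2Z \<partial>hyp_measure)"
    by (simp add: nn_integral_multc)
  also have "\<dots> = (\<integral>\<^sup>+g. \<integral>\<^sup>+z. \<Psi> (sl2_act g z) * indicator modular_domain z \<partial>hyp_measure \<partial>count_space SL2Z)"
    by (rule nn_integral_count_space_nn_integral[OF countable_SL2Z]) simp
  also have "\<dots> = (\<integral>\<^sup>+g. \<integral>\<^sup>+z. \<Psi> z * indicator modular_domain (sl2_act (sl2_inv g) z) \<partial>hyp_measure \<partial>count_space SL2Z)"
  proof (rule nn_integral_cong)
    fix g assume "g \<in> space (count_space SL2Z)"
    then have g: "g \<in> SL2Z" by simp
    \<comment> \<open>Writing \<open>z\<close> as \<open>sl2_inv g\<close> applied to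
      \<open>sl2_act g z\<close> makes the whole integrand a function of \<open>sl2_act g z\<close>,
      so that invariance applies.\<close>
    have "(\<integral>\<^sup>+z. \<Psi> (sl2_act g z) * indicator modular_domain z \<partial>hyp_measure) =
        (\<integral>\<^sup>+z. \<Psi> (sl2_act g z) * indicator modular_domain (sl2_act (sl2_inv g) (sl2_act g z)) \<partial>hyp_measure)"
      by (rule nn_integral_cong_AE, rule AE_mp[OF AE_hyp_measure_pos]) (auto simp: sl2_act_inverse[OF g])
    also have "\<dots> = (\<integral>\<^sup>+z. \<Psi> z * indicator modular_domain (sl2_act (sl2_inv g) z) \<partial>hyp_measure)"
      by (rule nn_integral_hyp_measure_sl2_act[OF _ g]) simp
    finally show "(\<integral>\<^sup>+z. \<Psi> (sl2_act g z) * indicator modular_domain z \<partial>hyp_measure) =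
        (\<integral>\<^sup>+z. \<Psi> z * indicator modular_domain (sl2_act (sl2_inv g) z) \<partial>hyp_measure)" .
  qed
  also have "\<dots> = (\<integral>\<^sup>+g. \<integral>\<^sup>+z. \<Psi> z * indicator modular_domain (sl2_act g z) \<partial>hyp_measure \<partial>count_space SL2Z)"
    by (rule nn_integral_bij_count_space[OF bij_betw_sl2_inv])
  also have "\<dots> = (\<integral>\<^sup>+z. \<integral>\<^sup>+g. \<Psi> z * indicator modular_domain (sl2_act g z) \<partial>count_space SL2Z \<partial>hyp_measure)"
    by (rule nn_integral_count_space_nn_integral[OF countable_SL2Z, symmetric]) simp
  also have "\<dots> = (\<integral>\<^sup>+z. 2 * \<Psi> z \<partial>hyp_measure)"
  proof (rule nn_integral_cong_AE, rule AE_mp[OF AE_hyp_measure_pos], rule AE_mp[OF AE_sl2_act_notin_walls],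
      rule AE_I2, intro impI)
    fix z assume z: "\<forall>g\<in>SL2Z. sl2_act g z \<notin> modular_walls" "snd z > 0"
    have card: "card {g \<in> SL2Z. sl2_act g z \<in> modular_domain} = 2"
      using card_sl2_act_in_domain[of "snd z" "fst z"] z by simp
    have "(\<integral>\<^sup>+g. indicator modular_domain (sl2_act g z) \<partial>count_space SL2Z) =
        (\<integral>\<^sup>+g. indicator {g \<in> SL2Z. sl2_act g z \<in> modular_domain} g \<partial>count_space SL2Z)"
      by (rule nn_integral_cong) (auto split: split_indicator)
    also have "\<dots> = 2"
      using card card_gt_0_iff[of "{g \<in> SL2Z. sl2_act g z \<in> modular_domain}"]
      by (simp add: emeasure_count_space_finite)
    finally show "(\<integral>\<^sup>+g. \<Psi> z * indicator modular_domain (sl2_act g z) \<partial>count_space SL2Z) = 2 * \<Psi> z"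
      by (simp add: nn_integral_cmult mult.commute)
  qed
  also have "\<dots> = 2 * (\<integral>\<^sup>+z. \<Psi> z \<partial>hyp_measure)"
    by (rule nn_integral_cmult) simp
  finally show ?thesis .
qed

section \<open>Polar coordinates\<close>

text \<open>Euclidean area is \<open>b\<^sup>2\<close> times hyperbolic area, so the slope
  coordinates of the latter can be reused.\<close>

lemma nn_integral_upper_half_plane_slope:
  fixes K :: "real \<times> real \<Rightarrow> ennreal"
  assumes [measurable]: "K \<in> borel_measurable borel"
  shows "(\<integral>\<^sup>+v. K v * indicator {0<..} (snd v) \<partial>lborel) =
    (\<integral>\<^sup>+s. (\<integral>\<^sup>+b\<in>{0<..}. ennreal b * K (s * b, b) \<partial>lborel) \<partial>lborel)"
proof -
  have "(\<integral>\<^sup>+v. K v * indicator {0<..} (snd v) \<partial>lborel) =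
      (\<integral>\<^sup>+b\<in>{0<..}. (\<integral>\<^sup>+a. K (a, b) \<partial>lborel) \<partial>lborel)"
    by (subst nn_integral_lborel_prod_iterated(1)) (simp_all add: nn_integral_multc)
  also have "\<dots> = (\<integral>\<^sup>+v. ennreal ((snd v)\<^sup>2) * K v \<partial>hyp_measure)"
  proof (subst nn_integral_hyp_measure, simp, intro nn_integral_cong)
    fix b :: real
    have "ennreal (1 / b\<^sup>2) * ennreal (b\<^sup>2) = 1" if "b > 0"
      using that by (simp flip: ennreal_mult)
    then show "(\<integral>\<^sup>+a. K (a, b) \<partial>lborel) * indicator {0<..} b =
        ennreal (1 / b\<^sup>2) * (\<integral>\<^sup>+x. ennreal ((snd (x, b))\<^sup>2) * K (x, b) \<partial>lborel) * indicator {0<..} b"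
      by (auto simp: nn_integral_cmult split: split_indicator simp flip: mult.assoc)
  qed
  also have "\<dots> = (\<integral>\<^sup>+s. (\<integral>\<^sup>+b\<in>{0<..}. ennreal b * K (s * b, b) \<partial>lborel) \<partial>lborel)"
  proof (subst nn_integral_hyp_measure_slope, simp, intro nn_integral_cong)
    fix s b :: real
    have "ennreal (1 / b) * ennreal (b\<^sup>2) = ennreal b" if "b > 0"
      using that by (simp flip: ennreal_mult add: power2_eq_square)
    then show "ennreal (1 / b) * (ennreal ((snd (s * b, b))\<^sup>2) * K (s * b, b)) * indicator {0<..} b =
        ennreal b * K (s * b, b) * indicator {0<..} b"
      by (auto split: split_indicator simp flip: mult.assoc)
  qed
  finally show ?thesis .
qed

text \<open>\<open>cos t / sin t\<close> is the cotangent, which maps the open interval bijectively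
  onto the line, with inverse \<open>s \<mapsto> pi / 2 - arctan s\<close>.\<close>

lemma nn_integral_cot_substitution:
  fixes f :: "real \<Rightarrow> ennreal"
  assumes [measurable]: "f \<in> borel_measurable borel"
  shows "(\<integral>\<^sup>+s. f s \<partial>lborel) = (\<integral>\<^sup>+t\<in>{0<..<pi}. ennreal (1 / (sin t)\<^sup>2) * f (cos t / sin t) \<partial>lborel)"
proof -
  have tan: "cos t / sin t = tan (pi / 2 - t)" for t :: real
    by (simp add: tan_def cos_diff sin_diff)
  have arctan: "arctan (cos t / sin t) = pi / 2 - t" if "0 < t" "t < pi" for t
    unfolding tan using that by (intro arctan_tan) auto
  have img: "(\<lambda>t. cos t / sin t) ` {0<..<pi} = UNIV"
  proof (intro equalityI subsetI UNIV_I)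
    fix s :: real
    show "s \<in> (\<lambda>t. cos t / sin t) ` {0<..<pi}"
      using arctan_bounded[of s]
      by (intro image_eqI[of _ _ "pi / 2 - arctan s"]) (auto simp: tan tan_arctan)
  qed
  have "(\<integral>\<^sup>+s\<in>(\<lambda>t. cos t / sin t) ` {0<..<pi}. f s \<partial>lborel) =
      (\<integral>\<^sup>+t\<in>{0<..<pi}. ennreal \<bar>- 1 / (sin t)\<^sup>2\<bar> * f (cos t / sin t) \<partial>lborel)"
  proof (rule nn_integral_substitution_inj_on)
    show "((\<lambda>t. cos t / sin t) has_real_derivative - 1 / (sin t)\<^sup>2) (at t)" if "t \<in> {0<..<pi}" for t
    proof -
      have "sin t \<noteq> 0" using sin_gt_zero[of t] that by auto
      moreover have "- (sin t * sin t) - cos t * cos t = - 1"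
        using sin_cos_squared_add[of t] by (simp add: power2_eq_square)
      ultimately show ?thesis
        by (auto intro!: derivative_eq_intros simp: power2_eq_square)
    qed
    show "inj_on (\<lambda>t. cos t / sin t) {0<..<pi}"
      by (rule inj_onI) (metis (no_types) arctan diff_left_imp_eq greaterThanLessThan_iff)
  qed (simp_all add: img)
  then show ?thesis by (simp add: img abs_divide)
qed

text \<open>For \<open>c = sin t\<close>, the number \<open>c / sqrt y\<close> is the height of the
  vector of length \<open>1 / sqrt y\<close> at the angle \<open>t\<close>.\<close>

lemma nn_integral_inverse_sqrt_substitution:
  fixes f :: "real \<Rightarrow> ennreal"
  assumes [measurable]: "f \<in> borel_measurable borel" and c: "c > 0"
  shows "(\<integral>\<^sup>+b\<in>{0<..}. ennreal b * f b \<partial>lborel) =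
    (\<integral>\<^sup>+y\<in>{0<..}. ennreal (c\<^sup>2 / (2 * y\<^sup>2)) * f (c / sqrt y) \<partial>lborel)"
proof -
  have img: "(\<lambda>y. c / sqrt y) ` {0<..} = {0<..}"
  proof (intro equalityI subsetI)
    fix b :: real assume "b \<in> {0<..}"
    then show "b \<in> (\<lambda>y. c / sqrt y) ` {0<..}"
      using c by (intro image_eqI[of _ _ "(c / b)\<^sup>2"]) auto
  qed (use c in auto)
  have "(\<integral>\<^sup>+b\<in>(\<lambda>y. c / sqrt y) ` {0<..}. ennreal b * f b \<partial>lborel) =
    (\<integral>\<^sup>+y\<in>{0<..}. ennreal \<bar>- c / (2 * y * sqrt y)\<bar> * (ennreal (c / sqrt y) * f (c / sqrt y)) \<partial>lborel)"
  proof (rule nn_integral_substitution_inj_on)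
    show "((\<lambda>y. c / sqrt y) has_real_derivative - c / (2 * y * sqrt y)) (at y)" if "y \<in> {0<..}" for y
      using that by (auto intro!: derivative_eq_intros simp: field_simps)
    show "inj_on (\<lambda>y. c / sqrt y) {0<..}"
      using c by (auto simp: inj_on_def field_simps)
  qed (simp_all add: img)
  also have "\<dots> = (\<integral>\<^sup>+y\<in>{0<..}. ennreal (c\<^sup>2 / (2 * y\<^sup>2)) * f (c / sqrt y) \<partial>lborel)"
  proof (rule nn_integral_cong)
    fix y :: real
    have "ennreal \<bar>- c / (2 * y * sqrt y)\<bar> * ennreal (c / sqrt y) = ennreal (c\<^sup>2 / (2 * y\<^sup>2))" if "y > 0"
    proof -
      have "c / (2 * y * sqrt y) * (c / sqrt y) = c\<^sup>2 / (2 * y * (sqrt y * sqrt y))"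
        by (simp add: power2_eq_square)
      then show ?thesis
        using that c by (simp flip: ennreal_mult add: abs_divide abs_mult power2_eq_square)
    qed
    then show "ennreal \<bar>- c / (2 * y * sqrt y)\<bar> * (ennreal (c / sqrt y) * f (c / sqrt y)) * indicator {0<..} y =
       ennreal (c\<^sup>2 / (2 * y\<^sup>2)) * f (c / sqrt y) * indicator {0<..} y"
      by (auto split: split_indicator simp flip: mult.assoc)
  qed
  finally show ?thesis by (simp add: img)
qed

text \<open>Polar coordinates with radius \<open>\<rho> = 1 / sqrt y\<close>: the area element
  \<open>\<rho> d\<rho> dt\<close> is \<open>dy dt / (2 y\<^sup>2)\<close>, whence the factor 2.
  They are reached through the slope \<open>cos t / sin t\<close> and the height
  \<open>sin t / sqrt y\<close>.\<close>

lemma nn_integral_polar: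
  fixes K :: "real \<times> real \<Rightarrow> ennreal"
  assumes [measurable]: "K \<in> borel_measurable borel"
  shows "(\<integral>\<^sup>+y\<in>{0<..}. ennreal (1 / y\<^sup>2) * (\<integral>\<^sup>+t\<in>{0<..<pi}. K (cos t / sqrt y, sin t / sqrt y) \<partial>lborel) \<partial>lborel) =
    2 * (\<integral>\<^sup>+v. K v * indicator {0<..} (snd v) \<partial>lborel)"
proof -
  have "2 * (\<integral>\<^sup>+v. K v * indicator {0<..} (snd v) \<partial>lborel) =
     2 * (\<integral>\<^sup>+t\<in>{0<..<pi}. ennreal (1 / (sin t)\<^sup>2) *
        (\<integral>\<^sup>+b\<in>{0<..}. ennreal b * K (cos t / sin t * b, b) \<partial>lborel) \<partial>lborel)"
    unfolding nn_integral_upper_half_plane_slope[OF assms]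
    by (subst nn_integral_cot_substitution) simp_all
  also have "\<dots> = 2 * (\<integral>\<^sup>+t. \<integral>\<^sup>+y. ennreal (1 / (2 * y\<^sup>2)) * K (cos t / sqrt y, sin t / sqrt y) *
       indicator {0<..} y * indicator {0<..<pi} t \<partial>lborel \<partial>lborel)"
  proof (intro arg_cong[of _ _ "\<lambda>u. 2 * u"] nn_integral_cong)
    fix t :: real
    show "ennreal (1 / (sin t)\<^sup>2) * (\<integral>\<^sup>+b\<in>{0<..}. ennreal b * K (cos t / sin t * b, b) \<partial>lborel) * indicator {0<..<pi} t =
      (\<integral>\<^sup>+y. ennreal (1 / (2 * y\<^sup>2)) * K (cos t / sqrt y, sin t / sqrt y) * indicator {0<..} y * indicator {0<..<pi} t \<partial>lborel)"
    proof (cases "t \<in> {0<..<pi}")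
      case True
      then have s: "sin t > 0" by (simp add: sin_gt_zero)
      have "ennreal (1 / (sin t)\<^sup>2) * (\<integral>\<^sup>+b\<in>{0<..}. ennreal b * K (cos t / sin t * b, b) \<partial>lborel) =
          (\<integral>\<^sup>+y. ennreal (1 / (sin t)\<^sup>2) * (ennreal ((sin t)\<^sup>2 / (2 * y\<^sup>2)) *
             K (cos t / sin t * (sin t / sqrt y), sin t / sqrt y) * indicator {0<..} y) \<partial>lborel)"
        by (subst nn_integral_inverse_sqrt_substitution[OF _ s]) (simp_all add: nn_integral_cmult)
      also have "\<dots> = (\<integral>\<^sup>+y\<in>{0<..}. ennreal (1 / (2 * y\<^sup>2)) * K (cos t / sqrt y, sin t / sqrt y) \<partial>lborel)"
      proof (rule nn_integral_cong)
        fix y :: real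
        have "ennreal (1 / (sin t)\<^sup>2) * ennreal ((sin t)\<^sup>2 / (2 * y\<^sup>2)) = ennreal (1 / (2 * y\<^sup>2))"
          using s by (simp flip: ennreal_mult)
        then show "ennreal (1 / (sin t)\<^sup>2) * (ennreal ((sin t)\<^sup>2 / (2 * y\<^sup>2)) *
             K (cos t / sin t * (sin t / sqrt y), sin t / sqrt y) * indicator {0<..} y) =
             ennreal (1 / (2 * y\<^sup>2)) * K (cos t / sqrt y, sin t / sqrt y) * indicator {0<..} y"
          using s by (simp flip: mult.assoc)
      qed
      finally show ?thesis using True by simp
    qed simp
  qed
  also have "\<dots> = 2 * (\<integral>\<^sup>+y. \<integral>\<^sup>+t. ennreal (1 / (2 * y\<^sup>2)) * K (cos t / sqrt y, sin t / sqrt y) *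
       indicator {0<..} y * indicator {0<..<pi} t \<partial>lborel \<partial>lborel)"
    by (subst lborel_pair.Fubini') simp_all
  also have "\<dots> = (\<integral>\<^sup>+y. 2 * (\<integral>\<^sup>+t. ennreal (1 / (2 * y\<^sup>2)) * K (cos t / sqrt y, sin t / sqrt y) *
       indicator {0<..} y * indicator {0<..<pi} t \<partial>lborel) \<partial>lborel)"
    by (simp add: nn_integral_cmult)
  also have "\<dots> = (\<integral>\<^sup>+y\<in>{0<..}. ennreal (1 / y\<^sup>2) * (\<integral>\<^sup>+t\<in>{0<..<pi}. K (cos t / sqrt y, sin t / sqrt y) \<partial>lborel) \<partial>lborel)"
  proof (rule nn_integral_cong)
    fix y :: real
    have "2 * ennreal (1 / (2 * y\<^sup>2)) = ennreal (1 / y\<^sup>2)"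
      by (simp flip: ennreal_numeral ennreal_mult)
    moreover have "(\<integral>\<^sup>+t. ennreal (1 / (2 * y\<^sup>2)) * K (cos t / sqrt y, sin t / sqrt y) *
       indicator {0<..} y * indicator {0<..<pi} t \<partial>lborel) =
       ennreal (1 / (2 * y\<^sup>2)) * indicator {0<..} y * (\<integral>\<^sup>+t\<in>{0<..<pi}. K (cos t / sqrt y, sin t / sqrt y) \<partial>lborel)"
      by (subst nn_integral_cmult[symmetric]) (auto intro!: nn_integral_cong simp: ac_simps)
    ultimately show "2 * (\<integral>\<^sup>+t. ennreal (1 / (2 * y\<^sup>2)) * K (cos t / sqrt y, sin t / sqrt y) *
       indicator {0<..} y * indicator {0<..<pi} t \<partial>lborel) =
       ennreal (1 / y\<^sup>2) * (\<integral>\<^sup>+t\<in>{0<..<pi}. K (cos t / sqrt y, sin t / sqrt y) \<partial>lborel) * indicator {0<..} y"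
      by (simp only: mult.assoc mult.commute[of "indicator {0<..} y"] flip: mult.assoc[of 2])
  qed
  finally show ?thesis ..
qed

section \<open>Primitive vectors in the square\<close>

lemma rot_add: "rot (s + t) v = rot s (rot t v)"
  by (simp add: rot_def cos_add sin_add algebra_simps)

lemma rot_lincomb: "rot t (a *\<^sub>R v + b *\<^sub>R w) = a *\<^sub>R rot t v + b *\<^sub>R rot t w"
  by (simp add: rot_def algebra_simps)

lemma uminus_square_S: "- v \<in> square_S r \<longleftrightarrow> v \<in> square_S r"
  by (simp add: square_S_def)

lemma rot_add_pi: "rot (t + pi) v = - rot t v"
  by (simp add: rot_def prod_eq_iff)

text \<open>For \<open>y > 0\<close> this is the complex number \<open>m + n \<tau>\<close>, divided
  by \<open>sqrt y\<close> and turned by the angle \<open>t\<close>.\<close>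

definition lattice_vector :: "real \<times> real \<times> real \<Rightarrow> int \<Rightarrow> int \<Rightarrow> real \<times> real" where
  "lattice_vector = (\<lambda>(x, y, t) m n. rot t ((of_int m + of_int n * x) / sqrt y, of_int n * sqrt y))"

lemma lattice_coord_eq: "lattice_coord z = {lattice_vector z m n | m n. True}"
proof -
  obtain x y t where z: "z = (x, y, t)" by (cases z)
  have "of_int m *\<^sub>R rot t (1 / sqrt y, 0) + of_int n *\<^sub>R rot t (x / sqrt y, sqrt y) = lattice_vector z m n" for m n
    by (simp add: z lattice_vector_def add_divide_distrib flip: rot_lincomb)
  then show ?thesis by (simp add: z lattice_coord_def lattice_span_def)
qed

definition cross2 :: "real \<times> real \<Rightarrow> real \<times> real \<Rightarrow> real" where
  "cross2 v w = fst v * snd w - snd v * fst w"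

lemma cross2_rot: "cross2 (rot t v) (rot t w) = cross2 v w"
proof -
  have "cross2 (rot t v) (rot t w) = ((sin t)\<^sup>2 + (cos t)\<^sup>2) * cross2 v w"
    unfolding cross2_def rot_def fst_conv snd_conv by algebra
  then show ?thesis by simp
qed

lemma cross2_lattice_vector:
  assumes "y \<noteq> 0"
  shows "cross2 (lattice_vector (x, y, t) m n) (lattice_vector (x, y, t) p q) = of_int (m * q - n * p)"
  unfolding lattice_vector_def prod.case cross2_rot
  using assms by (simp add: cross2_def field_simps)

lemma norm_rot: "(fst (rot t v))\<^sup>2 + (snd (rot t v))\<^sup>2 = (fst v)\<^sup>2 + (snd v)\<^sup>2"
proof -
  have "(fst (rot t v))\<^sup>2 + (snd (rot t v))\<^sup>2 = ((sin t)\<^sup>2 + (cos t)\<^sup>2) * ((fst v)\<^sup>2 + (snd v)\<^sup>2)"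
    unfolding rot_def fst_conv snd_conv by algebra
  then show ?thesis by simp
qed

text \<open>The absolute value covers negative \<open>y\<close>, where \<open>sqrt y\<close> is
  negative with square \<open>\<bar>y\<bar>\<close>; such \<open>y\<close> occur when measurability
  is shown on the whole coordinate space.\<close>

lemma norm_lattice_vector:
  assumes "y \<noteq> 0"
  shows "(fst (lattice_vector (x, y, t) m n))\<^sup>2 + (snd (lattice_vector (x, y, t) m n))\<^sup>2 = qform x y m n / \<bar>y\<bar>"
proof -
  have sqrt: "(sqrt y)\<^sup>2 = \<bar>y\<bar>" by (simp add: power2_eq_square)
  have "(of_int n)\<^sup>2 * \<bar>y\<bar> = (of_int n * y)\<^sup>2 / \<bar>y\<bar>"
    using assms by (simp add: power2_eq_square field_simps)
  then show ?thesis
    unfolding lattice_vector_def prod.case norm_rot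
    by (simp only: fst_conv snd_conv qform_def power_divide power_mult_distrib[of _ "sqrt y"] sqrt flip: add_divide_distrib)
qed

lemma scaleR_lattice_vector: "of_int k *\<^sub>R lattice_vector z m n = lattice_vector z (k * m) (k * n)"
  by (cases z) (simp add: lattice_vector_def rot_def algebra_simps add_divide_distrib)

lemma lattice_vector_uminus: "lattice_vector z (- m) (- n) = - lattice_vector z m n"
  using scaleR_lattice_vector[of "-1" z m n] by simp

lemma lattice_vector_inject:
  assumes y: "y \<noteq> 0" and eq: "lattice_vector (x, y, t) m n = lattice_vector (x, y, t) m' n'"
  shows "m = m' \<and> n = n'"
proof -
  \<comment> \<open>The determinants against the two basis vectors are \<open>m\<close> and
    \<open>- n\<close>.\<close>
  have "cross2 (lattice_vector (x, y, t) m n) (lattice_vector (x, y, t) a b) =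
      cross2 (lattice_vector (x, y, t) m' n') (lattice_vector (x, y, t) a b)" for a b
    using eq by simp
  from this[of 0 1] this[of 1 0] show ?thesis
    unfolding cross2_lattice_vector[OF y] by simp
qed

text \<open>A vector is the gcd of its coordinates times a lattice vector, so primitivity forces gcd
  1; conversely, any integer factor of the vector divides both coordinates.\<close>

lemma primitive_vectors_lattice_coord:
  assumes y: "y \<noteq> 0"
  shows "primitive_vectors (lattice_coord (x, y, t)) = {lattice_vector (x, y, t) m n | m n. coprime m n}"
proof -
  have "lattice_vector (x, y, t) m n \<in> primitive_vectors (lattice_coord (x, y, t)) \<longleftrightarrow> coprime m n" for m n
  proof -
    have 0: "lattice_vector (x, y, t) 0 0 = 0" by (simp add: lattice_vector_def rot_def zero_prod_def)
    have nz: "lattice_vector (x, y, t) m n = 0 \<longleftrightarrow> m = 0 \<and> n = 0"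
      using lattice_vector_inject[OF y, of x t m n 0 0] 0 by auto
    have eq: "lattice_vector (x, y, t) m n = of_int k *\<^sub>R lattice_vector (x, y, t) a b \<longleftrightarrow> m = k * a \<and> n = k * b" for k a b
      unfolding scaleR_lattice_vector using lattice_vector_inject[OF y] by blast
    have ball: "(\<forall>w\<in>lattice_coord (x, y, t). P w) \<longleftrightarrow> (\<forall>a b. P (lattice_vector (x, y, t) a b))" for P
      unfolding lattice_coord_eq by blast
    have mem: "lattice_vector (x, y, t) m n \<in> lattice_coord (x, y, t)"
      unfolding lattice_coord_eq by blast
    have "lattice_vector (x, y, t) m n \<in> primitive_vectors (lattice_coord (x, y, t)) \<longleftrightarrow>
      \<not> (m = 0 \<and> n = 0) \<and> (\<forall>a b k. m = k * a \<and> n = k * b \<longrightarrow> \<bar>k\<bar> = 1)"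
      unfolding primitive_vectors_def mem_Collect_eq ball eq nz using mem by blast
    also have "\<dots> \<longleftrightarrow> coprime m n"
    proof (intro iffI conjI allI impI)
      assume *: "\<not> (m = 0 \<and> n = 0) \<and> (\<forall>a b k. m = k * a \<and> n = k * b \<longrightarrow> \<bar>k\<bar> = 1)"
      have "m = gcd m n * (m div gcd m n) \<and> n = gcd m n * (n div gcd m n)" by simp
      with * have "\<bar>gcd m n\<bar> = 1" by blast
      then show "coprime m n" by (simp add: coprime_iff_gcd_eq_1)
    next
      fix a b k assume "coprime m n" "m = k * a \<and> n = k * b"
      then have "k dvd 1" by (metis coprime_common_divisor dvd_triv_left)
      then show "\<bar>k\<bar> = 1" by simp
    qed auto
    finally show ?thesis .
  qed
  moreover have "primitive_vectors (lattice_coord (x, y, t)) \<subseteq> {lattice_vector (x, y, t) m n | m n. True}"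
    by (auto simp: primitive_vectors_def lattice_coord_eq)
  ultimately show ?thesis by blast
qed

section \<open>Counting pairs of primitive vectors in the square\<close>

definition short_primitive :: "real \<Rightarrow> real \<times> real \<times> real \<Rightarrow> (int \<times> int) set" where
  "short_primitive r z = {(m, n). coprime m n \<and> lattice_vector z m n \<in> square_S r}"

text \<open>The square lies in the disc of squared radius \<open>2 * (exp (- r))\<^sup>2\<close>,
  which contains finitely many lattice points.\<close>

lemma finite_short_primitive:
  assumes y: "y \<noteq> 0"
  shows "finite (short_primitive r (x, y, t))"
proof (rule finite_subset[OF _ finite_qform_le[OF y, of x "2 * (exp (- r))\<^sup>2 * \<bar>y\<bar>"]], clarify)
  fix m n assume "(m, n) \<in> short_primitive r (x, y, t)"
  then have "\<bar>fst (lattice_vector (x, y, t) m n)\<bar> < exp (- r)" "\<bar>snd (lattice_vector (x, y, t) m n)\<bar> < exp (- r)"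
    by (auto simp: short_primitive_def square_S_def)
  then have "(fst (lattice_vector (x, y, t) m n))\<^sup>2 \<le> (exp (- r))\<^sup>2" "(snd (lattice_vector (x, y, t) m n))\<^sup>2 \<le> (exp (- r))\<^sup>2"
    by (simp_all add: abs_le_square_iff[symmetric])
  then have "qform x y m n / \<bar>y\<bar> \<le> 2 * (exp (- r))\<^sup>2"
    unfolding norm_lattice_vector[OF y, of x t m n, symmetric] by linarith
  then show "qform x y m n \<le> 2 * (exp (- r))\<^sup>2 * \<bar>y\<bar>"
    using y by (simp add: pos_divide_le_eq)
qed

lemma siegel_pr_f_ind:
  assumes y: "y \<noteq> 0"
  shows "siegel_pr (f_ind r) (lattice_coord (x, y, t)) = real (card (short_primitive r (x, y, t)))"
proof -
  define V where "V = case_prod (lattice_vector (x, y, t))"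
  have inj: "inj_on V A" for A
    using lattice_vector_inject[OF y] by (auto simp: V_def inj_on_def)
  have prim: "primitive_vectors (lattice_coord (x, y, t)) = V ` {(m, n). coprime m n}"
    unfolding primitive_vectors_lattice_coord[OF y] by (auto simp: V_def)
  have "siegel_pr (f_ind r) (lattice_coord (x, y, t)) = (\<Sum>\<^sub>\<infinity>c\<in>{(m, n). coprime m n}. f_ind r (V c))"
    unfolding siegel_pr_def prim by (simp add: infsum_reindex[OF inj] o_def)
  also have "\<dots> = (\<Sum>\<^sub>\<infinity>c\<in>short_primitive r (x, y, t). 1)"
    by (rule infsum_cong_neutral) (auto simp: short_primitive_def V_def f_ind_def split: split_indicator)
  also have "\<dots> = real (card (short_primitive r (x, y, t)))"
    by (simp add: finite_short_primitive[OF y])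
  finally show ?thesis .
qed

text \<open>Once \<open>(m, n)\<close> is completed to a basis, determinant zero makes
  \<open>(p, q)\<close> an integer multiple \<open>a\<close> of \<open>(m, n)\<close>, and
  \<open>a\<close> divides the coprime numbers \<open>p\<close> and \<open>q\<close>.\<close>

lemma det_zero_coprime:
  fixes m n p q :: int
  assumes "coprime m n" "coprime p q" "m * q = n * p"
  shows "(p, q) = (m, n) \<or> (p, q) = (- m, - n)"
proof -
  obtain p0 q0 where "(m, n, p0, q0) \<in> SL2Z" using coprime_imp_SL2Z[OF assms(1)] .
  then have det: "m * q0 - n * p0 = 1" by (simp add: SL2Z_def)
  define a where "a = p * q0 - q * p0"
  have pq: "p = a * m" "q = a * n" using det assms(3) unfolding a_def by algebra+
  then have "a dvd 1" using assms(2) by (metis coprime_common_divisor dvd_triv_left)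
  then have "a = 1 \<or> a = - 1" by auto
  then show ?thesis using pq by auto
qed

text \<open>Here \<open>r \<ge> 0\<close> enters: all coordinates are below 1 in absolute value,
  hence so are both products in the determinant.\<close>

lemma abs_cross2_square_S:
  assumes "v \<in> square_S r" "w \<in> square_S r" "r \<ge> 0"
  shows "\<bar>cross2 v w\<bar> < 2"
proof -
  have e: "exp (- r) \<le> 1" using assms(3) by simp
  have bd: "\<bar>fst v\<bar> < 1" "\<bar>snd v\<bar> < 1" "\<bar>fst w\<bar> < 1" "\<bar>snd w\<bar> < 1"
    using assms(1,2) less_le_trans[OF _ e] by (auto simp only: square_S_def mem_Collect_eq)
  have "\<bar>a * b\<bar> < 1" if "\<bar>a\<bar> < 1" "\<bar>b\<bar> < 1" for a b :: real
    using mult_strict_mono'[of "\<bar>a\<bar>" 1 "\<bar>b\<bar>" 1] that by (simp add: abs_mult)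
  then have "\<bar>fst v * snd w\<bar> < 1" "\<bar>snd v * fst w\<bar> < 1" using bd by blast+
  then show ?thesis unfolding cross2_def by linarith
qed

lemma card_square_short_primitive:
  fixes r x y t :: real
  assumes y: "y \<noteq> 0" and r: "r \<ge> 0"
  defines "N \<equiv> short_primitive r (x, y, t)"
  shows "(card N)\<^sup>2 = 2 * card N + 2 * card {(m, n, p, q) \<in> SL2Z. (m, n) \<in> N \<and> (p, q) \<in> N}"
proof -
  have fin: "finite N" unfolding N_def by (rule finite_short_primitive[OF y])
  define Z where "Z k = {((m, n), (p, q)) |m n p q. (m, n) \<in> N \<and> (p, q) \<in> N \<and> m * q - n * p = k}" for k
  have sub: "Z k \<subseteq> N \<times> N" for k by (auto simp: Z_def)
  have finZ: "finite (Z k)" for k using finite_subset[OF sub] fin by auto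
  have "N \<times> N = Z 0 \<union> (Z 1 \<union> Z (- 1))"
  proof (intro equalityI subsetI)
    fix c assume "c \<in> N \<times> N"
    then obtain m n p q where c: "c = ((m, n), (p, q))" "(m, n) \<in> N" "(p, q) \<in> N" by auto
    then have "\<bar>real_of_int (m * q - n * p)\<bar> < 2"
      using abs_cross2_square_S[OF _ _ r, of "lattice_vector (x, y, t) m n" "lattice_vector (x, y, t) p q"]
      unfolding cross2_lattice_vector[OF y] by (auto simp: N_def short_primitive_def)
    then have "\<bar>m * q - n * p\<bar> < 2" by linarith
    then have "m * q - n * p = 0 \<or> m * q - n * p = 1 \<or> m * q - n * p = - 1" by linarith
    then show "c \<in> Z 0 \<union> (Z 1 \<union> Z (- 1))" using c by (auto simp: Z_def)
  qed (use sub in blast)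
  moreover have "Z k \<inter> Z l = {}" if "k \<noteq> l" for k l using that by (auto simp: Z_def)
  ultimately have "card (N \<times> N) = card (Z 0) + (card (Z 1) + card (Z (- 1)))"
    using finZ by (simp add: card_Un_disjoint Int_Un_distrib)
  \<comment> \<open>Swapping the two vectors changes the sign of the determinant.\<close>
  moreover have "card (Z (- 1)) = card (Z 1)"
    by (rule bij_betw_same_card[of "\<lambda>(v, w). (w, v)"], rule bij_betwI[where g = "\<lambda>(v, w). (w, v)"])
      (auto simp: Z_def algebra_simps)
  moreover have "card (Z 1) = card {(m, n, p, q) \<in> SL2Z. (m, n) \<in> N \<and> (p, q) \<in> N}"
    by (rule bij_betw_same_card[of "\<lambda>((m, n), (p, q)). (m, n, p, q)"],
        rule bij_betwI[where g = "\<lambda>(m, n, p, q). ((m, n), (p, q))"]) (auto simp: Z_def SL2Z_def)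
  moreover have "card (Z 0) = 2 * card N"
  proof -
    define f where "f = (\<lambda>c :: int \<times> int. (c, c))"
    define h where "h = (\<lambda>c :: int \<times> int. (c, - c))"
    have neg: "- c \<in> N" if "c \<in> N" for c
      using that by (cases c) (auto simp: N_def short_primitive_def lattice_vector_uminus uminus_square_S)
    have "Z 0 = f ` N \<union> h ` N"
    proof (intro equalityI subsetI)
      fix c assume "c \<in> Z 0"
      then obtain m n p q where c: "c = ((m, n), (p, q))" "(m, n) \<in> N" "(p, q) \<in> N" "m * q = n * p"
        by (auto simp: Z_def)
      then have "(p, q) = (m, n) \<or> (p, q) = (- m, - n)"
        by (intro det_zero_coprime) (auto simp: N_def short_primitive_def)
      then show "c \<in> f ` N \<union> h ` N" using c by (auto simp: f_def h_def)
    qed (use neg in \<open>auto simp: f_def h_def Z_def\<close>)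
    \<comment> \<open>A common element would give \<open>c = - c\<close>, so
      \<open>c = (0, 0)\<close>, which is not a coprime pair.\<close>
    moreover have "f ` N \<inter> h ` N = {}"
      by (auto simp: f_def h_def N_def short_primitive_def)
    moreover have "card (f ` N) = card N" "card (h ` N) = card N"
      by (auto intro!: card_image simp: inj_on_def f_def h_def)
    ultimately show ?thesis using fin by (simp add: card_Un_disjoint)
  qed
  ultimately show ?thesis by (simp add: card_cartesian_product power2_eq_square)
qed

text \<open>The completions of \<open>(m, n)\<close> to a positive basis differ by integer multiples
  of \<open>(m, n)\<close> in the second row, which translates the modulus by integers; the
  half-open unit interval selects exactly one. Single vectors are thereby counted inside
  \<open>SL2Z\<close>.\<close>

lemma bij_betw_based_pairs:
  assumes y: "y > 0" and cop: "\<And>m n. (m, n) \<in> N \<Longrightarrow> coprime m n"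
  shows "bij_betw (\<lambda>g. (fst g, fst (snd g)))
    {g \<in> SL2Z. (fst g, fst (snd g)) \<in> N \<and> fst (sl2_act g (x, y)) \<in> {0..<1}} N"
    (is "bij_betw _ ?A _")
proof (unfold bij_betw_def, intro conjI)
  show "inj_on (\<lambda>g. (fst g, fst (snd g))) ?A"
  proof (rule inj_onI)
    fix g g' assume g: "g \<in> ?A" and g': "g' \<in> ?A" and eq: "(fst g, fst (snd g)) = (fst g', fst (snd g'))"
    obtain m n p q where [simp]: "g = (m, n, p, q)" by (metis prod_cases4)
    obtain p' q' where [simp]: "g' = (m, n, p', q')" using eq by (cases g') auto
    have A: "(m, n, p, q) \<in> SL2Z" "fst (sl2_act (m, n, p, q) (x, y)) \<in> {0..<1}"
      and A': "(m, n, p', q') \<in> SL2Z" "fst (sl2_act (m, n, p', q') (x, y)) \<in> {0..<1}"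
      using g g' by auto
    have det: "m * q - n * p = 1" "m * q' - n * p' = 1" using A A' by (auto simp: SL2Z_def)
    define k where "k = p' * q - q' * p"
    have pq': "p' = p + k * m" "q' = q + k * n" using det unfolding k_def by algebra+
    have Q: "qform x y m n > 0" using qform_pos[OF A(1)] y by simp
    have "0 \<le> bform x y m n p q / qform x y m n" "bform x y m n p q / qform x y m n < 1"
      "0 \<le> bform x y m n p q / qform x y m n + of_int k" "bform x y m n p q / qform x y m n + of_int k < 1"
      using A A' Q by (simp_all add: sl2_act_eq pq' SL2Z_shear(2)[OF A(1)] add_divide_distrib)
    then have "k = 0" by linarith
    then show "g = g'" by (simp add: pq')
  qed
  show "(\<lambda>g. (fst g, fst (snd g))) ` ?A = N"
  proof (intro equalityI subsetI)
    fix c assume c: "c \<in> N"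
    obtain m n where mn: "c = (m, n)" by (cases c)
    obtain p q where pq: "(m, n, p, q) \<in> SL2Z" using coprime_imp_SL2Z cop c mn by blast
    define k where "k = - \<lfloor>bform x y m n p q / qform x y m n\<rfloor>"
    have Q: "qform x y m n > 0" using qform_pos[OF pq] y by simp
    have "fst (sl2_act (m, n, p + k * m, q + k * n) (x, y)) = bform x y m n p q / qform x y m n + of_int k"
      using Q by (simp add: sl2_act_eq SL2Z_shear(2)[OF pq] add_divide_distrib)
    also have "\<dots> \<in> {0..<1}" unfolding k_def by (simp; linarith)
    finally have "(m, n, p + k * m, q + k * n) \<in> ?A"
      using SL2Z_shear(1)[OF pq, of k] c mn by simp
    then show "c \<in> (\<lambda>g. (fst g, fst (snd g))) ` ?A"
      by (rule rev_image_eqI) (simp add: mn)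
  qed auto
qed

section \<open>The square of the Siegel transform as a sum over bases\<close>

lemma borel_measurable_square_S [measurable]: "square_S r \<in> sets borel"
  unfolding square_S_def by measurable

lemma borel_measurable_rot [measurable (raw)]:
  assumes [measurable]: "f \<in> borel_measurable M" "h \<in> borel_measurable M"
  shows "(\<lambda>x. rot (f x) (h x)) \<in> borel_measurable M"
  unfolding rot_def by measurable

text \<open>The contribution of one positive basis with modulus \<open>z\<close> and first vector at
  angle \<open>t\<close>. The factor 2 stands for the two signs in the pairs \<open>(v, v)\<close>,
  \<open>(v, - v)\<close> and for the two orders of a pair that forms a basis.\<close>

definition basis_weight :: "real \<Rightarrow> real \<times> real \<Rightarrow> real \<Rightarrow> ennreal" where
  "basis_weight r z t = 2 * indicator (square_S r) (rot t (1 / sqrt (snd z), 0)) *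
     (indicator {0..<1} (fst z) + indicator (square_S r) (rot t (fst z / sqrt (snd z), sqrt (snd z))))"

lemma borel_measurable_basis_weight [measurable (raw)]:
  assumes [measurable]: "f \<in> borel_measurable M" "h \<in> borel_measurable M"
  shows "(\<lambda>x. basis_weight r (f x) (h x)) \<in> borel_measurable M"
  unfolding basis_weight_def by measurable

text \<open>Rotation by \<open>pi\<close> is \<open>v \<mapsto> - v\<close>, which preserves the
  square; the angle thus matters only modulo \<open>pi\<close>.\<close>

lemma basis_weight_periodic: "basis_weight r z (t + pi) = basis_weight r z t"
  by (simp add: basis_weight_def rot_add_pi indicator_def uminus_square_S)

text \<open>The normalised frame of the basis \<open>(A, B)\<close> is turned by the argument
  \<open>a\<close> of \<open>A = m + n \<tau>\<close>, the same for all \<open>t\<close>.\<close>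

lemma sl2_act_angle:
  assumes g: "(m, n, p, q) \<in> SL2Z" and y: "y > 0" and z': "sl2_act (m, n, p, q) (x, y) = (x', y')"
  shows "\<exists>a. \<forall>t. rot (a + t) (1 / sqrt y', 0) = lattice_vector (x, y, t) m n \<and>
    rot (a + t) (x' / sqrt y', sqrt y') = lattice_vector (x, y, t) p q"
proof -
  define J where "J = qform x y m n"
  define C where "C = bform x y m n p q"
  have J: "J > 0" unfolding J_def using qform_pos[OF g] y by simp
  have x': "x' = C / J" and y': "y' = y / J" using z' by (auto simp: sl2_act_eq J_def C_def)
  have J_eq: "J = (of_int m + of_int n * x)\<^sup>2 + (of_int n * y)\<^sup>2" by (simp add: J_def qform_def)
  have "((of_int m + of_int n * x) / sqrt J)\<^sup>2 + (of_int n * y / sqrt J)\<^sup>2 = 1"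
    using J by (simp add: power_divide J_eq[symmetric] flip: add_divide_distrib)
  then obtain a where a: "(of_int m + of_int n * x) / sqrt J = cos a" "of_int n * y / sqrt J = sin a"
    by (metis sincos_total_2pi)
  have sq: "sqrt y * sqrt y = y" "sqrt J * sqrt J = J" using y J by simp_all
  have det: "real_of_int m * real_of_int q - real_of_int n * real_of_int p = 1"
    by (rule real_det_SL2Z[OF g])
  have 1: "rot a (1 / sqrt y', 0) = ((of_int m + of_int n * x) / sqrt y, of_int n * sqrt y)"
  proof -
    have "of_int n * y / sqrt y = of_int n * sqrt y"
      using y by (simp add: real_div_sqrt flip: times_divide_eq_right)
    then show ?thesis
      using J y by (simp add: rot_def a[symmetric] y' real_sqrt_divide)
  qed
  have 2: "rot a (x' / sqrt y', sqrt y') = ((of_int p + of_int q * x) / sqrt y, of_int q * sqrt y)"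
  proof -
    \<comment> \<open>\<open>e1\<close> and \<open>e2\<close> are the real and the imaginary part of
      \<open>A * \<tau>' = B\<close> times \<open>J\<close>, where \<open>\<tau>'\<close> is the new
      modulus; the imaginary part is divided by \<open>y\<close>.\<close>
    have e1: "(of_int m + of_int n * x) * C - of_int n * y * y = (of_int p + of_int q * x) * J"
      using det unfolding J_eq C_def bform_def by algebra
    have e2: "of_int n * C + (of_int m + of_int n * x) = of_int q * J"
      using det unfolding J_eq C_def bform_def by algebra
    have xs: "x' / sqrt y' = C / (sqrt J * sqrt y)" and ys: "sqrt y' = sqrt y / sqrt J"
      using J y by (simp_all add: x' y' real_sqrt_divide field_simps)
    have "cos a * (x' / sqrt y') - sin a * sqrt y' =
        ((of_int m + of_int n * x) * C - of_int n * y * (sqrt y * sqrt y)) / ((sqrt J * sqrt J) * sqrt y)"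
      unfolding xs unfolding ys a[symmetric] using J y by (simp add: field_simps del: real_sqrt_mult_self)
    also have "\<dots> = (of_int p + of_int q * x) / sqrt y"
      unfolding sq e1 using J by simp
    finally have *: "cos a * (x' / sqrt y') - sin a * sqrt y' = (of_int p + of_int q * x) / sqrt y" .
    have "sin a * (x' / sqrt y') + cos a * sqrt y' =
        (y * (of_int n * C) + (of_int m + of_int n * x) * (sqrt y * sqrt y)) / ((sqrt J * sqrt J) * sqrt y)"
      unfolding xs unfolding ys a[symmetric] using J y by (simp add: field_simps del: real_sqrt_mult_self)
    also have "\<dots> = (of_int n * C + (of_int m + of_int n * x)) * y / (J * sqrt y)"
      unfolding sq by (simp add: algebra_simps)
    also have "\<dots> = of_int q * (y / sqrt y)"
      unfolding e2 using J by simp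
    finally have "sin a * (x' / sqrt y') + cos a * sqrt y' = of_int q * sqrt y"
      using y by (simp add: real_div_sqrt)
    with * show ?thesis by (simp add: rot_def)
  qed
  show ?thesis
    by (rule exI[of _ a]) (simp add: add.commute[of a] rot_add 1 2 lattice_vector_def)
qed

text \<open>The contribution of the basis \<open>g\<close>, expressed by vectors of the fixed
  lattice at \<open>z\<close>; a change of angle turns it into \<open>basis_weight\<close> at the
  modulus given by \<open>sl2_act g\<close>.\<close>

definition pair_weight :: "real \<Rightarrow> real \<times> real \<times> real \<Rightarrow> int \<times> int \<times> int \<times> int \<Rightarrow> ennreal" where
  "pair_weight r z = (\<lambda>(m, n, p, q). 2 * indicator (square_S r) (lattice_vector z m n) *
     (indicator {0..<1} (fst (sl2_act (m, n, p, q) (fst z, fst (snd z)))) +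
      indicator (square_S r) (lattice_vector z p q)))"

text \<open>\<open>A\<close> counts the single vectors through their distinguished completions and
  \<open>B\<close> the positively oriented pairs. As both are subsets of \<open>SL2Z\<close>, the
  count of all pairs becomes one sum over the group.\<close>

lemma siegel_square_eq_nn_integral:
  assumes y: "y > 0" and r: "r \<ge> 0"
  shows "ennreal ((siegel_pr (f_ind r) (lattice_coord (x, y, t)))\<^sup>2) =
    (\<integral>\<^sup>+g. pair_weight r (x, y, t) g
      \<partial>count_space SL2Z)"
proof -
  define N where "N = short_primitive r (x, y, t)"
  define A where "A = {g \<in> SL2Z. (fst g, fst (snd g)) \<in> N \<and> fst (sl2_act g (x, y)) \<in> {0..<1}}"
  define B where "B = {(m, n, p, q) \<in> SL2Z. (m, n) \<in> N \<and> (p, q) \<in> N}"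
  have fin: "finite N" unfolding N_def using finite_short_primitive y by simp
  have bij: "bij_betw (\<lambda>g. (fst g, fst (snd g))) A N"
    unfolding A_def by (rule bij_betw_based_pairs[OF y]) (auto simp: N_def short_primitive_def)
  have "finite A" "card A = card N"
    using bij_betw_finite[OF bij] bij_betw_same_card[OF bij] fin by auto
  moreover have "finite B"
    by (rule finite_subset[of _ "(\<lambda>((m, n), (p, q)). (m, n, p, q)) ` (N \<times> N)"])
      (use fin in \<open>force simp: B_def\<close>)+
  moreover have sub: "A \<subseteq> SL2Z" "B \<subseteq> SL2Z" by (auto simp: A_def B_def)
  ultimately have em: "emeasure (count_space SL2Z) A = of_nat (card N)"
      "emeasure (count_space SL2Z) B = of_nat (card B)"
    by (simp_all add: emeasure_count_space_finite)
  have "(card N)\<^sup>2 = 2 * card N + 2 * card B"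
    unfolding N_def B_def using card_square_short_primitive[of y r x t] y r by simp
  moreover have "ennreal ((real (card N))\<^sup>2) = of_nat ((card N)\<^sup>2)"
    by (simp add: ennreal_of_nat_eq_real_of_nat)
  ultimately have "ennreal ((real (card N))\<^sup>2) = 2 * emeasure (count_space SL2Z) A + 2 * emeasure (count_space SL2Z) B"
    by (simp add: em)
  also have "\<dots> = (\<integral>\<^sup>+g. 2 * indicator A g + 2 * indicator B g \<partial>count_space SL2Z)"
    using sub by (simp add: nn_integral_add nn_integral_cmult)
  also have "\<dots> = (\<integral>\<^sup>+g. pair_weight r (x, y, t) g
      \<partial>count_space SL2Z)"
  proof (rule nn_integral_cong)
    fix g assume "g \<in> space (count_space SL2Z)"
    moreover obtain m n p q where gg: "g = (m, n, p, q)" by (metis prod_cases4)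
    ultimately have g: "(m, n, p, q) \<in> SL2Z" by simp
    have "(m, n) \<in> N \<longleftrightarrow> lattice_vector (x, y, t) m n \<in> square_S r"
         "(p, q) \<in> N \<longleftrightarrow> lattice_vector (x, y, t) p q \<in> square_S r"
      using SL2Z_coprime[OF g] by (auto simp: N_def short_primitive_def)
    then show "2 * indicator A g + 2 * indicator B g = pair_weight r (x, y, t) g"
      using g by (auto simp: gg A_def B_def pair_weight_def indicator_def)
  qed
  finally show ?thesis
    using siegel_pr_f_ind[of y r x t] y by (simp add: N_def)
qed

text \<open>The offset \<open>a g\<close> of the angle depends on the basis but not on
  \<open>t\<close>, and integration over a full period removes it.\<close>

lemma nn_integral_siegel_square_circle:
  assumes y: "y > 0" and r: "r \<ge> 0"
  shows "(\<integral>\<^sup>+t\<in>{0..<pi}. ennreal ((siegel_pr (f_ind r) (lattice_coord (x, y, t)))\<^sup>2) \<partial>lborel) =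
    (\<integral>\<^sup>+g. (\<integral>\<^sup>+t\<in>{0..<pi}. basis_weight r (sl2_act g (x, y)) t \<partial>lborel) \<partial>count_space SL2Z)"
proof -
  have "\<exists>a. \<forall>t. pair_weight r (x, y, t) g =
       basis_weight r (sl2_act g (x, y)) (a + t)" if gS: "g \<in> SL2Z" for g
  proof -
    obtain m n p q where g: "g = (m, n, p, q)" by (metis prod_cases4)
    obtain x' y' where z': "sl2_act g (x, y) = (x', y')" by fastforce
    obtain a where "\<forall>t. rot (a + t) (1 / sqrt y', 0) = lattice_vector (x, y, t) m n \<and>
        rot (a + t) (x' / sqrt y', sqrt y') = lattice_vector (x, y, t) p q"
      using sl2_act_angle[of m n p q y x x' y'] gS y z' by (auto simp: g)
    then show ?thesis
      using z' by (intro exI[of _ a]) (simp add: g basis_weight_def pair_weight_def)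
  qed
  then obtain a where a: "\<And>g t. g \<in> SL2Z \<Longrightarrow>
      pair_weight r (x, y, t) g =
       basis_weight r (sl2_act g (x, y)) (a g + t)"
    by metis
  have "(\<integral>\<^sup>+t\<in>{0..<pi}. ennreal ((siegel_pr (f_ind r) (lattice_coord (x, y, t)))\<^sup>2) \<partial>lborel) =
      (\<integral>\<^sup>+t\<in>{0..<pi}. (\<integral>\<^sup>+g. basis_weight r (sl2_act g (x, y)) (a g + t) \<partial>count_space SL2Z) \<partial>lborel)"
    unfolding siegel_square_eq_nn_integral[OF assms]
    by (intro nn_integral_cong arg_cong2[of _ _ _ _ "(*)"] refl) (simp add: a)
  also have "\<dots> = (\<integral>\<^sup>+t. \<integral>\<^sup>+g. basis_weight r (sl2_act g (x, y)) (a g + t) * indicator {0..<pi} t \<partial>count_space SL2Z \<partial>lborel)"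
    by (simp add: nn_integral_multc)
  also have "\<dots> = (\<integral>\<^sup>+g. (\<integral>\<^sup>+t\<in>{0..<pi}. basis_weight r (sl2_act g (x, y)) (a g + t) \<partial>lborel) \<partial>count_space SL2Z)"
    by (rule nn_integral_count_space_nn_integral[OF countable_SL2Z]) simp
  also have "\<dots> = (\<integral>\<^sup>+g. (\<integral>\<^sup>+t\<in>{0..<pi}. basis_weight r (sl2_act g (x, y)) t \<partial>lborel) \<partial>count_space SL2Z)"
    by (intro nn_integral_cong nn_integral_periodic_shift) (simp_all add: basis_weight_periodic)
  finally show ?thesis .
qed

text \<open>The coordinates are junk for \<open>y \<le> 0\<close>, but measurability is needed there as well: for \<open>y < 0\<close>
  the two vectors still form a basis (\<open>sqrt y\<close> is negative), for \<open>y = 0\<close> both vanish.\<close>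
lemma borel_measurable_siegel_pr:
  "(\<lambda>z. siegel_pr (f_ind r) (lattice_coord z)) \<in> borel_measurable borel"
proof -
  define W where "W z = (\<integral>\<^sup>+c. indicator (square_S r) (lattice_vector z (fst c) (snd c))
      \<partial>count_space {(m, n). coprime m n})" for z
  have cnt: "countable {(m :: int, n :: int). coprime m n}" by (rule countableI_type)
  interpret sigma_finite_measure "count_space {(m :: int, n :: int). coprime m n}"
    by (rule sigma_finite_measure_count_space_countable[OF cnt])
  have [measurable]: "W \<in> borel_measurable borel"
    unfolding W_def
  proof (rule borel_measurable_nn_integral)
    have "(\<lambda>w. (\<lambda>c w. indicator (square_S r) (lattice_vector (fst w) (fst c) (snd c)) :: ennreal) (snd w) w)
        \<in> borel_measurable (borel \<Otimes>\<^sub>M count_space {(m :: int, n :: int). coprime m n})"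
    \<comment> \<open>Joint measurability in the lattice and the integer pair reduces to each of the
      countably many pairs.\<close>
    proof (rule measurable_compose_countable'[OF _ _ cnt])
      fix c :: "int \<times> int"
      show "(\<lambda>w. indicator (square_S r) (lattice_vector (fst w) (fst c) (snd c)) :: ennreal)
          \<in> borel_measurable (borel \<Otimes>\<^sub>M count_space {(m :: int, n :: int). coprime m n})"
        unfolding lattice_vector_def case_prod_beta by measurable
    qed simp
    then show "(\<lambda>(z, c). indicator (square_S r) (lattice_vector z (fst c) (snd c)) :: ennreal)
        \<in> borel_measurable (borel \<Otimes>\<^sub>M count_space {(m :: int, n :: int). coprime m n})"
      by (simp add: case_prod_beta')
  qed
  have "siegel_pr (f_ind r) (lattice_coord z) = (if fst (snd z) = 0 then 0 else enn2real (W z))" for z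
  proof -
    obtain x y t where z: "z = (x, y, t)" by (cases z)
    show ?thesis
    proof (cases "y = 0")
      case True
      have "lattice_coord z = {0}"
        unfolding lattice_coord_eq by (auto simp: z True lattice_vector_def rot_def zero_prod_def)
      then have "primitive_vectors (lattice_coord z) = {}" by (auto simp: primitive_vectors_def)
      then show ?thesis by (simp add: siegel_pr_def z True)
    next
      case False
      have "W z = (\<integral>\<^sup>+c. indicator (short_primitive r z) c \<partial>count_space {(m, n). coprime m n})"
        unfolding W_def by (rule nn_integral_cong) (auto simp: short_primitive_def indicator_def)
      also have "\<dots> = of_nat (card (short_primitive r z))"
        using finite_short_primitive[OF False, of r x t]
        by (subst nn_integral_indicator)
          (auto simp: z short_primitive_def intro!: emeasure_count_space_finite)
      finally show ?thesis using siegel_pr_f_ind[OF False, of r x t] False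
        by (simp add: z enn2real_of_nat)
    qed
  qed
  then show ?thesis by (simp add: measurable_If)
qed

section \<open>The second moment of the Siegel transform\<close>

lemma nn_integral_lborel_triple:
  fixes f :: "real \<times> real \<times> real \<Rightarrow> ennreal"
  assumes [measurable]: "f \<in> borel_measurable borel"
  shows "(\<integral>\<^sup>+p. f p \<partial>lborel) = (\<integral>\<^sup>+z. \<integral>\<^sup>+t. f (fst z, snd z, t) \<partial>lborel \<partial>lborel)"
proof -
  have "(\<integral>\<^sup>+p. f p \<partial>lborel) = (\<integral>\<^sup>+x. \<integral>\<^sup>+w. f (x, w) \<partial>lborel \<partial>lborel)"
    using lborel.nn_integral_fst[of f lborel] by (simp add: lborel_prod borel_prod)
  also have "\<dots> = (\<integral>\<^sup>+x. \<integral>\<^sup>+y. \<integral>\<^sup>+t. f (x, y, t) \<partial>lborel \<partial>lborel \<partial>lborel)"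
    by (intro nn_integral_cong nn_integral_lborel_prod_iterated(2)) simp
  also have "\<dots> = (\<integral>\<^sup>+z. \<integral>\<^sup>+t. f (fst z, snd z, t) \<partial>lborel \<partial>lborel)"
    by (subst nn_integral_lborel_prod_iterated(2)) simp_all
  finally show ?thesis .
qed

lemma borel_measurable_fund_dom [measurable]: "fund_dom \<in> sets borel"
proof -
  have "{p::real \<times> real \<times> real. \<bar>fst p\<bar> \<le> 1/2 \<and> (fst p)\<^sup>2 + (fst (snd p))\<^sup>2 \<ge> 1 \<and> 0 < fst (snd p) \<and>
      0 \<le> snd (snd p) \<and> snd (snd p) < pi} \<in> sets borel"
    by measurable
  then show ?thesis by (simp add: fund_dom_def case_prod_beta')
qed

text \<open>The fundamental domain is the product of \<open>modular_domain\<close> with the interval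
  of angles, and Haar measure is hyperbolic area times \<open>dt\<close>.\<close>

lemma nn_integral_mu_X:
  assumes [measurable]: "G \<in> borel_measurable borel"
  shows "(\<integral>\<^sup>+p. G p \<partial>mu_X) = ennreal (3 / pi\<^sup>2) *
    (\<integral>\<^sup>+z\<in>modular_domain. (\<integral>\<^sup>+t\<in>{0..<pi}. G (fst z, snd z, t) \<partial>lborel) \<partial>hyp_measure)"
proof -
  have "(\<integral>\<^sup>+p. G p \<partial>mu_X) =
      (\<integral>\<^sup>+p. ennreal (indicator fund_dom p * (3 / pi\<^sup>2) / (fst (snd p))\<^sup>2) * G p \<partial>lborel)"
    unfolding mu_X_def by (rule nn_integral_density) auto
  also have "\<dots> = (\<integral>\<^sup>+z. \<integral>\<^sup>+t. ennreal (indicator fund_dom (fst z, snd z, t) * (3 / pi\<^sup>2) / (snd z)\<^sup>2) *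
      G (fst z, snd z, t) \<partial>lborel \<partial>lborel)"
    by (subst nn_integral_lborel_triple) simp_all
  also have "\<dots> = (\<integral>\<^sup>+z. ennreal (indicator {0<..} (snd z) / (snd z)\<^sup>2) * (ennreal (3 / pi\<^sup>2) *
      ((\<integral>\<^sup>+t\<in>{0..<pi}. G (fst z, snd z, t) \<partial>lborel) * indicator modular_domain z)) \<partial>lborel)"
  proof (rule nn_integral_cong)
    fix z :: "real \<times> real"
    have "(\<integral>\<^sup>+t. ennreal (indicator fund_dom (fst z, snd z, t) * (3 / pi\<^sup>2) / (snd z)\<^sup>2) * G (fst z, snd z, t) \<partial>lborel) =
        (\<integral>\<^sup>+t. ennreal (indicator {0<..} (snd z) / (snd z)\<^sup>2) * ennreal (3 / pi\<^sup>2) * indicator modular_domain z *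
          (G (fst z, snd z, t) * indicator {0..<pi} t) \<partial>lborel)"
    proof (rule nn_integral_cong)
      fix t :: real
      show "ennreal (indicator fund_dom (fst z, snd z, t) * (3 / pi\<^sup>2) / (snd z)\<^sup>2) * G (fst z, snd z, t) =
        ennreal (indicator {0<..} (snd z) / (snd z)\<^sup>2) * ennreal (3 / pi\<^sup>2) * indicator modular_domain z *
          (G (fst z, snd z, t) * indicator {0..<pi} t)"
        by (cases z) (auto simp: fund_dom_def modular_domain_def indicator_def mult.commute simp flip: ennreal_mult)
    qed
    also have "\<dots> = ennreal (indicator {0<..} (snd z) / (snd z)\<^sup>2) * ennreal (3 / pi\<^sup>2) * indicator modular_domain z *
        (\<integral>\<^sup>+t\<in>{0..<pi}. G (fst z, snd z, t) \<partial>lborel)"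
      by (rule nn_integral_cmult) simp
    finally show "(\<integral>\<^sup>+t. ennreal (indicator fund_dom (fst z, snd z, t) * (3 / pi\<^sup>2) / (snd z)\<^sup>2) * G (fst z, snd z, t) \<partial>lborel) =
      ennreal (indicator {0<..} (snd z) / (snd z)\<^sup>2) * (ennreal (3 / pi\<^sup>2) *
      ((\<integral>\<^sup>+t\<in>{0..<pi}. G (fst z, snd z, t) \<partial>lborel) * indicator modular_domain z))"
      by (simp add: ac_simps)
  qed
  also have "\<dots> = (\<integral>\<^sup>+z. ennreal (3 / pi\<^sup>2) *
      ((\<integral>\<^sup>+t\<in>{0..<pi}. G (fst z, snd z, t) \<partial>lborel) * indicator modular_domain z) \<partial>hyp_measure)"
    unfolding hyp_measure_def by (rule nn_integral_density[symmetric]) simp_all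
  also have "\<dots> = ennreal (3 / pi\<^sup>2) *
    (\<integral>\<^sup>+z\<in>modular_domain. (\<integral>\<^sup>+t\<in>{0..<pi}. G (fst z, snd z, t) \<partial>lborel) \<partial>hyp_measure)"
    by (rule nn_integral_cmult) simp
  finally show ?thesis .
qed

lemma nn_integral_siegel_square_unfolded:
  assumes r: "r \<ge> 0"
  shows "(\<integral>\<^sup>+p. ennreal ((siegel_pr (f_ind r) (lattice_coord p))\<^sup>2) \<partial>mu_X) =
    ennreal (6 / pi\<^sup>2) * (\<integral>\<^sup>+z. (\<integral>\<^sup>+t\<in>{0..<pi}. basis_weight r z t \<partial>lborel) \<partial>hyp_measure)"
proof -
  note borel_measurable_siegel_pr[measurable]
  define \<Psi> where "\<Psi> z = (\<integral>\<^sup>+t\<in>{0..<pi}. basis_weight r z t \<partial>lborel)" for z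
  have [measurable]: "\<Psi> \<in> borel_measurable borel" unfolding \<Psi>_def by measurable
  have "(\<integral>\<^sup>+p. ennreal ((siegel_pr (f_ind r) (lattice_coord p))\<^sup>2) \<partial>mu_X) = ennreal (3 / pi\<^sup>2) *
      (\<integral>\<^sup>+z\<in>modular_domain. (\<integral>\<^sup>+t\<in>{0..<pi}.
        ennreal ((siegel_pr (f_ind r) (lattice_coord (fst z, snd z, t)))\<^sup>2) \<partial>lborel) \<partial>hyp_measure)"
    by (rule nn_integral_mu_X) simp
  also have "\<dots> = ennreal (3 / pi\<^sup>2) *
      (\<integral>\<^sup>+z\<in>modular_domain. (\<integral>\<^sup>+g. \<Psi> (sl2_act g z) \<partial>count_space SL2Z) \<partial>hyp_measure)"
  proof (intro arg_cong[of _ _ "\<lambda>u. ennreal (3 / pi\<^sup>2) * u"] nn_integral_cong)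
    fix z :: "real \<times> real"
    show "(\<integral>\<^sup>+t\<in>{0..<pi}. ennreal ((siegel_pr (f_ind r) (lattice_coord (fst z, snd z, t)))\<^sup>2) \<partial>lborel) * indicator modular_domain z =
        (\<integral>\<^sup>+g. \<Psi> (sl2_act g z) \<partial>count_space SL2Z) * indicator modular_domain z"
      using nn_integral_siegel_square_circle[OF _ r, of "snd z" "fst z"]
      by (cases "z \<in> modular_domain") (auto simp: modular_domain_def \<Psi>_def)
  qed
  also have "\<dots> = ennreal (3 / pi\<^sup>2) * (2 * (\<integral>\<^sup>+z. \<Psi> z \<partial>hyp_measure))"
    by (simp add: nn_integral_modular_unfolding)
  also have "\<dots> = ennreal (6 / pi\<^sup>2) * (\<integral>\<^sup>+z. \<Psi> z \<partial>hyp_measure)"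
  proof -
    have "ennreal (3 / pi\<^sup>2) * 2 = ennreal (6 / pi\<^sup>2)"
      by (simp flip: ennreal_numeral ennreal_mult)
    then show ?thesis by (simp flip: mult.assoc)
  qed
  finally show ?thesis by (simp add: \<Psi>_def)
qed

text \<open>For \<open>v \<noteq> 0\<close> the line \<open>cross2 v w = 1\<close> consists of the
  points \<open>w\<close> equal to \<open>x * v\<close> plus the quarter turn of \<open>v\<close>
  over its squared length. The length is measured in the parameter \<open>x\<close>, the real part
  of \<open>w / v\<close>, not in Euclidean units.\<close>

definition chord_length :: "real \<Rightarrow> real \<times> real \<Rightarrow> ennreal" where
  "chord_length r v = (\<integral>\<^sup>+x. indicator (square_S r)
     (x * fst v - snd v / ((fst v)\<^sup>2 + (snd v)\<^sup>2), x * snd v + fst v / ((fst v)\<^sup>2 + (snd v)\<^sup>2)) \<partial>lborel)"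

lemma borel_measurable_chord_length [measurable]: "chord_length r \<in> borel_measurable borel"
proof -
  have "(\<lambda>v. \<integral>\<^sup>+x. indicator (square_S r) (x * A v - B v, x * C v + D v) \<partial>lborel) \<in> borel_measurable borel"
    if [measurable]: "A \<in> borel_measurable borel" "B \<in> borel_measurable borel"
      "C \<in> borel_measurable borel" "D \<in> borel_measurable borel" for A B C D :: "real \<times> real \<Rightarrow> real"
    by measurable
  then show ?thesis unfolding chord_length_def by this measurable
qed

text \<open>For a fixed first vector \<open>v\<close>, integration over \<open>x\<close> turns the
  unit interval into 1 and the second indicator into the chord length; \<open>y\<close> and
  \<open>t\<close> are then polar coordinates of \<open>v\<close>. Of the factor 4, one 2 comes from
  the weight and one from the polar coordinates.\<close>

lemma nn_integral_basis_weight: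
  "(\<integral>\<^sup>+z. (\<integral>\<^sup>+t\<in>{0..<pi}. basis_weight r z t \<partial>lborel) \<partial>hyp_measure) =
    4 * (\<integral>\<^sup>+v. indicator (square_S r) v * (1 + chord_length r v) * indicator {0<..} (snd v) \<partial>lborel)"
proof -
  define K where "K v = 2 * (indicator (square_S r) v * (1 + chord_length r v))" for v
  have [measurable]: "K \<in> borel_measurable borel" unfolding K_def by measurable
  have "(\<integral>\<^sup>+z. (\<integral>\<^sup>+t\<in>{0..<pi}. basis_weight r z t \<partial>lborel) \<partial>hyp_measure) =
      (\<integral>\<^sup>+y\<in>{0<..}. ennreal (1 / y\<^sup>2) * (\<integral>\<^sup>+x. (\<integral>\<^sup>+t\<in>{0..<pi}. basis_weight r (x, y) t \<partial>lborel) \<partial>lborel) \<partial>lborel)"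
    by (rule nn_integral_hyp_measure) simp
  also have "\<dots> = (\<integral>\<^sup>+y\<in>{0<..}. ennreal (1 / y\<^sup>2) * (\<integral>\<^sup>+t\<in>{0<..<pi}. K (cos t / sqrt y, sin t / sqrt y) \<partial>lborel) \<partial>lborel)"
  proof (rule nn_integral_cong)
    fix y :: real
    have "(\<integral>\<^sup>+x. (\<integral>\<^sup>+t\<in>{0..<pi}. basis_weight r (x, y) t \<partial>lborel) \<partial>lborel) =
        (\<integral>\<^sup>+t\<in>{0<..<pi}. K (cos t / sqrt y, sin t / sqrt y) \<partial>lborel)" if y: "y > 0"
    proof -
      have "(\<integral>\<^sup>+x. (\<integral>\<^sup>+t\<in>{0..<pi}. basis_weight r (x, y) t \<partial>lborel) \<partial>lborel) =
          (\<integral>\<^sup>+t. \<integral>\<^sup>+x. basis_weight r (x, y) t * indicator {0..<pi} t \<partial>lborel \<partial>lborel)"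
        by (rule lborel_pair.Fubini') simp
      also have "\<dots> = (\<integral>\<^sup>+t\<in>{0..<pi}. K (cos t / sqrt y, sin t / sqrt y) \<partial>lborel)"
      proof (rule nn_integral_cong)
        fix t :: real
        \<comment> \<open>Dividing by the squared length of \<open>v\<close> is multiplying by
          \<open>y\<close>, which matches the second basis vector with the formula in
          \<open>chord_length\<close>.\<close>
        have N: "(cos t / sqrt y)\<^sup>2 + (sin t / sqrt y)\<^sup>2 = 1 / y"
          using y by (simp add: power_divide flip: add_divide_distrib)
        have sq: "y * w / sqrt y = sqrt y * w" for w
          using y by (simp add: real_div_sqrt flip: times_divide_eq_left)
        have "(\<integral>\<^sup>+x. basis_weight r (x, y) t \<partial>lborel) =
            2 * indicator (square_S r) (cos t / sqrt y, sin t / sqrt y) *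
            ((\<integral>\<^sup>+x. indicator {0..<1::real} x \<partial>lborel) +
             (\<integral>\<^sup>+x. indicator (square_S r) (rot t (x / sqrt y, sqrt y)) \<partial>lborel))"
          by (simp add: basis_weight_def nn_integral_cmult nn_integral_add rot_def)
        also have "(\<integral>\<^sup>+x. indicator (square_S r) (rot t (x / sqrt y, sqrt y)) \<partial>lborel) =
            chord_length r (cos t / sqrt y, sin t / sqrt y)"
          unfolding chord_length_def fst_conv snd_conv N
          by (rule nn_integral_cong) (simp add: rot_def sq mult.commute)
        finally show "(\<integral>\<^sup>+x. basis_weight r (x, y) t * indicator {0..<pi} t \<partial>lborel) =
            K (cos t / sqrt y, sin t / sqrt y) * indicator {0..<pi} t"
          by (simp add: nn_integral_multc K_def mult.assoc)
      qed
      also have "\<dots> = (\<integral>\<^sup>+t\<in>{0<..<pi}. K (cos t / sqrt y, sin t / sqrt y) \<partial>lborel)"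
        by (rule nn_integral_cong_AE, rule AE_mp[OF AE_lborel_singleton[of 0]])
          (auto simp: indicator_def intro!: AE_I2)
      finally show ?thesis .
    qed
    then show "ennreal (1 / y\<^sup>2) * (\<integral>\<^sup>+x. (\<integral>\<^sup>+t\<in>{0..<pi}. basis_weight r (x, y) t \<partial>lborel) \<partial>lborel) * indicator {0<..} y =
        ennreal (1 / y\<^sup>2) * (\<integral>\<^sup>+t\<in>{0<..<pi}. K (cos t / sqrt y, sin t / sqrt y) \<partial>lborel) * indicator {0<..} y"
      by (auto split: split_indicator)
  qed
  also have "\<dots> = 2 * (\<integral>\<^sup>+v. K v * indicator {0<..} (snd v) \<partial>lborel)"
    by (rule nn_integral_polar) simp
  also have "\<dots> = 2 * (2 * (\<integral>\<^sup>+v. indicator (square_S r) v * (1 + chord_length r v) * indicator {0<..} (snd v) \<partial>lborel))"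
    unfolding K_def by (simp add: mult.assoc nn_integral_cmult)
  finally show ?thesis by (simp flip: mult.assoc)
qed

section \<open>Chords of the square and integration over a quadrant\<close>

lemma nn_integral_even:
  fixes h :: "real \<Rightarrow> ennreal"
  assumes [measurable]: "h \<in> borel_measurable borel" and even: "\<And>a. h (- a) = h a"
  shows "(\<integral>\<^sup>+a. h a \<partial>lborel) = 2 * (\<integral>\<^sup>+a\<in>{0<..}. h a \<partial>lborel)"
proof -
  have "(\<integral>\<^sup>+a. h a \<partial>lborel) = (\<integral>\<^sup>+a. h a * indicator {0<..} a + h a * indicator {..<0} a \<partial>lborel)"
    by (rule nn_integral_cong_AE, rule AE_mp[OF AE_lborel_singleton[of 0]])
      (auto simp: indicator_def intro!: AE_I2)
  also have "\<dots> = (\<integral>\<^sup>+a\<in>{0<..}. h a \<partial>lborel) + (\<integral>\<^sup>+a\<in>{..<0}. h a \<partial>lborel)"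
    by (rule nn_integral_add) simp_all
  also have "(\<integral>\<^sup>+a\<in>{..<0}. h a \<partial>lborel) = (\<integral>\<^sup>+a\<in>{0<..}. h a \<partial>lborel)"
    by (subst nn_integral_real_affine[of _ "-1" 0])
      (auto intro!: nn_integral_cong simp: even split: split_indicator)
  finally show ?thesis by (simp add: mult_2)
qed

text \<open>With \<open>x\<close> replaced by \<open>- x\<close>, the points of the line for
  \<open>(- a, b)\<close> are the mirror images in the horizontal axis of those for
  \<open>(a, b)\<close>, and the square has this symmetry.\<close>

lemma chord_length_reflect: "chord_length r (- a, b) = chord_length r (a, b)"
proof -
  have "chord_length r (- a, b) = (\<integral>\<^sup>+x. indicator (square_S r)
     (- x * - a - b / (a\<^sup>2 + b\<^sup>2), - x * b + - a / (a\<^sup>2 + b\<^sup>2)) \<partial>lborel)"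
    unfolding chord_length_def by (subst nn_integral_real_affine[of _ "-1" 0]) simp_all
  also have "\<dots> = chord_length r (a, b)"
    unfolding chord_length_def
  proof (rule nn_integral_cong)
    fix x :: real
    have "- x * b + - a / (a\<^sup>2 + b\<^sup>2) = - (x * b + a / (a\<^sup>2 + b\<^sup>2))" by simp
    then have "\<bar>- x * b + - a / (a\<^sup>2 + b\<^sup>2)\<bar> = \<bar>x * b + a / (a\<^sup>2 + b\<^sup>2)\<bar>"
      by (simp only: abs_minus_cancel)
    then show "indicator (square_S r) (- x * - a - b / (a\<^sup>2 + b\<^sup>2), - x * b + - a / (a\<^sup>2 + b\<^sup>2)) =
      (indicator (square_S r) (x * fst (a, b) - snd (a, b) / ((fst (a, b))\<^sup>2 + (snd (a, b))\<^sup>2),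
         x * snd (a, b) + fst (a, b) / ((fst (a, b))\<^sup>2 + (snd (a, b))\<^sup>2)) :: ennreal)"
      unfolding indicator_def square_S_def by (simp only: mem_Collect_eq fst_conv snd_conv) simp
  qed
  finally show ?thesis .
qed

text \<open>Both coordinates of \<open>w\<close> increase with \<open>x\<close>, so the chord enters
  the square on the left side, at \<open>x = l\<close>, and leaves it through the top, at
  \<open>x = u\<close>. The other two inequalities follow from the determinant equation
  \<open>key\<close>, since \<open>e * a\<close> and \<open>e * b\<close> are below 1.\<close>

lemma chord_length_quadrant:
  assumes a: "a > 0" and b: "b > 0" and v: "(a, b) \<in> square_S r" and r: "r \<ge> 0"
  shows "chord_length r (a, b) =
    indicator (D_reg r) (a, b) * ennreal (exp (- r) / a + exp (- r) / b - 1 / (a * b))"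
proof -
  define e where "e = exp (- r)"
  define N where "N = a\<^sup>2 + b\<^sup>2"
  have e: "0 < e" "e \<le> 1" using r by (auto simp: e_def)
  have ab: "a < e" "b < e" using v a b by (auto simp: square_S_def e_def)
  have N: "N > 0" using a by (simp add: N_def add_pos_nonneg)
  define l where "l = (b / N - e) / a"
  define u where "u = (e - a / N) / b"
  have ul: "u - l = e / a + e / b - 1 / (a * b)"
  proof -
    have "u - l = e / a + e / b - N / (N * a * b)"
      using a b N by (simp add: u_def l_def field_simps) (simp add: N_def power2_eq_square algebra_simps)
    then show ?thesis using N by simp
  qed
  have ul': "u - l = (e * (a + b) - 1) / (a * b)"
    unfolding ul using a b by (simp add: field_simps)
  have ea: "e * a < 1" "e * b < 1"
    using mult_strict_mono'[of a 1 e 1] mult_strict_mono'[of b 1 e 1] ab e a b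
    by (auto simp: mult.commute intro: le_less_trans[OF mult_right_le_one_le])
  have "{x. (x * a - b / N, x * b + a / N) \<in> square_S r} = {l<..<u}"
  proof (intro equalityI subsetI)
    fix x assume "x \<in> {x. (x * a - b / N, x * b + a / N) \<in> square_S r}"
    then have "x * a - b / N > - e" "x * b + a / N < e" by (auto simp: square_S_def e_def)
    then show "x \<in> {l<..<u}" using a b by (simp add: l_def u_def field_simps)
  next
    fix x assume x: "x \<in> {l<..<u}"
    then have 1: "x * a - b / N > - e" and 2: "x * b + a / N < e"
      using a b by (simp_all add: l_def u_def pos_divide_less_eq pos_less_divide_eq)
    have key: "b * (x * a - b / N) = a * (x * b + a / N) - 1"
    proof -
      have "a * (a / N) + b * (b / N) = N / N"
        by (simp add: N_def power2_eq_square flip: add_divide_distrib)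
      then show ?thesis using N by (simp add: algebra_simps)
    qed
    have "a * (x * b + a / N) < a * e" using 2 a by simp
    then have "b * (x * a - b / N) < 0" using key ea(1) by (simp add: mult.commute)
    then have 3: "x * a - b / N < e" using b e by (simp add: mult_less_0_iff)
    have "b * (x * a - b / N) > b * - e" using 1 b by (simp only: mult_less_cancel_left_pos)
    then have "a * (x * b + a / N) > 0" using key ea(2) by (simp add: mult.commute)
    then have 4: "x * b + a / N > - e" using a e by (simp add: zero_less_mult_iff)
    show "x \<in> {x. (x * a - b / N, x * b + a / N) \<in> square_S r}"
      using 1 2 3 4 by (simp add: square_S_def e_def abs_less_iff)
  qed
  then have "chord_length r (a, b) = (\<integral>\<^sup>+x. indicator {l<..<u} x \<partial>lborel)"
    unfolding chord_length_def by (intro nn_integral_cong) (auto simp: N_def indicator_def set_eq_iff)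
  also have "\<dots> = emeasure lborel {l<..<u}" by simp
  also have "\<dots> = indicator (D_reg r) (a, b) * ennreal (u - l)"
  proof -
    \<comment> \<open>The numerator \<open>e * (a + b) - 1\<close> of \<open>u - l\<close> is
      positive exactly on \<open>D_reg\<close>; elsewhere the interval is empty.\<close>
    have "(a, b) \<in> D_reg r \<longleftrightarrow> 1 / e < a + b"
      using v a b by (simp add: D_reg_def e_def exp_minus field_simps)
    also have "\<dots> \<longleftrightarrow> l < u"
      using ul' a b e by (simp add: pos_divide_less_eq mult.commute less_divide_eq flip: diff_gt_0_iff_gt[of _ l])
    finally show ?thesis by (cases "l < u") (auto simp: indicator_def)
  qed
  finally show ?thesis unfolding ul by (simp add: e_def)
qed

definition chord_density :: "real \<Rightarrow> real \<times> real \<Rightarrow> real" where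
  "chord_density r v = exp (- r) / fst v + exp (- r) / snd v - 1 / (fst v * snd v)"

lemma borel_measurable_chord_density [measurable]: "chord_density r \<in> borel_measurable borel"
  unfolding chord_density_def by measurable

lemma borel_measurable_D_reg [measurable]: "D_reg r \<in> sets borel"
proof -
  have "{v \<in> space borel. v \<in> square_S r \<and> 0 < fst v \<and> 0 < snd v \<and> exp r < fst v + snd v} \<in> sets borel"
    by measurable
  then show ?thesis by (simp add: D_reg_def)
qed

text \<open>As \<open>a + b > 1\<close>, one coordinate is at least \<open>1 / 2\<close>, so the
  other is at most \<open>2 * (a * b)\<close>. That other coordinate also bounds the numerator
  \<open>e * (a + b) - 1\<close>, both coordinates being below 1.\<close>

lemma chord_density_D_reg:
  assumes "v \<in> D_reg r" "r \<ge> 0"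
  shows "0 \<le> chord_density r v" "chord_density r v \<le> 2"
proof -
  define a where "a = fst v"
  define b where "b = snd v"
  define e where "e = exp (- r)"
  have e: "0 < e" "e \<le> 1" using assms(2) by (auto simp: e_def)
  have ab: "0 < a" "0 < b" "a < e" "b < e" "exp r < a + b"
    using assms(1) by (auto simp: D_reg_def square_S_def a_def b_def e_def)
  have eq: "chord_density r v = (e * (a + b) - 1) / (a * b)"
    using ab by (simp add: chord_density_def a_def[symmetric] b_def[symmetric] e_def[symmetric] field_simps)
  have "e * exp r < e * (a + b)" using ab(5) e by simp
  then have "1 < e * (a + b)" by (simp add: e_def flip: exp_add)
  then show "0 \<le> chord_density r v" unfolding eq using ab by simp
  have "1 \<le> exp r" using assms(2) by simp
  then have max: "a \<ge> 1 / 2 \<or> b \<ge> 1 / 2" using ab(5) by linarith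
  have "e * (a + b) \<le> a + b" using mult_right_mono[of e 1 "a + b"] e ab by simp
  moreover have "a \<le> 2 * (a * b) \<or> b \<le> 2 * (a * b)"
    using max mult_left_mono[of "1 / 2" b a] mult_right_mono[of "1 / 2" a b] ab by auto
  ultimately have "e * (a + b) - 1 \<le> 2 * (a * b)" using ab e by linarith
  then show "chord_density r v \<le> 2" unfolding eq using ab by (simp add: pos_divide_le_eq)
qed

text \<open>Reflection in the vertical axis reduces the upper half of the square to the first
  quadrant, with a factor 2; there the summand 1 contributes the area
  \<open>(exp (- r))\<^sup>2\<close>.\<close>

lemma nn_integral_half_square:
  assumes r: "r \<ge> 0"
  shows "(\<integral>\<^sup>+v. indicator (square_S r) v * (1 + chord_length r v) * indicator {0<..} (snd v) \<partial>lborel) =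
    2 * (ennreal ((exp (- r))\<^sup>2) + (\<integral>\<^sup>+v\<in>D_reg r. ennreal (chord_density r v) \<partial>lborel))"
proof -
  define e where "e = exp (- r)"
  define H where "H v = indicator (square_S r) v * (1 + chord_length r v) * indicator {0<..} (snd v)" for v
  have [measurable]: "H \<in> borel_measurable borel" unfolding H_def by measurable
  have even: "H (- a, b) = H (a, b)" for a b
    by (simp add: H_def chord_length_reflect square_S_def indicator_def)
  have quad: "H (a, b) * indicator {0<..} a = indicator {0<..<e} a * indicator {0<..<e} b +
      ennreal (chord_density r (a, b)) * indicator (D_reg r) (a, b)" for a b
  proof (cases "0 < a \<and> 0 < b \<and> (a, b) \<in> square_S r")
    case True
    then have "a < e" "b < e" by (auto simp: square_S_def e_def)
    then show ?thesis
      using True chord_length_quadrant[of a b r] r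
      by (simp add: H_def chord_density_def mult.commute)
  next
    case False
    then have "(a, b) \<notin> D_reg r" "\<not> (a \<in> {0<..<e} \<and> b \<in> {0<..<e})"
      by (auto simp: D_reg_def square_S_def e_def)
    moreover have "H (a, b) * indicator {0<..} a = 0" using False by (auto simp: H_def indicator_def)
    ultimately show ?thesis by (auto simp: indicator_def)
  qed
  have "(\<integral>\<^sup>+v. H v \<partial>lborel) = (\<integral>\<^sup>+b. \<integral>\<^sup>+a. H (a, b) \<partial>lborel \<partial>lborel)"
    by (rule nn_integral_lborel_prod_iterated(1)) simp
  also have "\<dots> = (\<integral>\<^sup>+b. 2 * (\<integral>\<^sup>+a\<in>{0<..}. H (a, b) \<partial>lborel) \<partial>lborel)"
    by (intro nn_integral_cong nn_integral_even) (simp_all add: even)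
  also have "\<dots> = 2 * (\<integral>\<^sup>+b. \<integral>\<^sup>+a. indicator {0<..<e} a * indicator {0<..<e} b +
      ennreal (chord_density r (a, b)) * indicator (D_reg r) (a, b) \<partial>lborel \<partial>lborel)"
    unfolding quad by (rule nn_integral_cmult) simp
  also have "\<dots> = 2 * ((\<integral>\<^sup>+b. ennreal e * indicator {0<..<e} b \<partial>lborel) +
      (\<integral>\<^sup>+b. \<integral>\<^sup>+a. ennreal (chord_density r (a, b)) * indicator (D_reg r) (a, b) \<partial>lborel \<partial>lborel))"
    by (simp add: nn_integral_add nn_integral_multc e_def)
  also have "(\<integral>\<^sup>+b. ennreal e * indicator {0<..<e} b \<partial>lborel) = ennreal (e\<^sup>2)"
    by (simp add: nn_integral_cmult e_def power2_eq_square ennreal_mult)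
  also have "(\<integral>\<^sup>+b. \<integral>\<^sup>+a. ennreal (chord_density r (a, b)) * indicator (D_reg r) (a, b) \<partial>lborel \<partial>lborel) =
      (\<integral>\<^sup>+v\<in>D_reg r. ennreal (chord_density r v) \<partial>lborel)"
    by (rule nn_integral_lborel_prod_iterated(1)[symmetric]) simp
  finally show ?thesis by (simp add: H_def e_def)
qed

lemma nn_integral_chord_density_finite:
  assumes r: "r \<ge> 0"
  shows "(\<integral>\<^sup>+v\<in>D_reg r. ennreal (chord_density r v) \<partial>lborel) < \<infinity>"
proof -
  have "D_reg r \<subseteq> cbox (0, 0) (1, 1)"
  proof
    fix v assume v: "v \<in> D_reg r"
    have e: "exp (- r) \<le> 1" using r by simp
    have "0 < fst v" "fst v < exp (- r)" "0 < snd v" "snd v < exp (- r)"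
      using v by (auto simp: D_reg_def square_S_def)
    then have "fst v \<in> cbox 0 1" "snd v \<in> cbox 0 1" using e by (auto simp del: exp_le_one_iff)
    then show "v \<in> cbox (0, 0) (1, 1)" by (cases v) (simp add: cbox_Pair_eq)
  qed
  then have "ennreal (chord_density r v) * indicator (D_reg r) v \<le> 2 * indicator (cbox (0, 0) (1, 1)) v" for v
    using chord_density_D_reg(2)[OF _ r, of v] ennreal_leI[of "chord_density r v" 2]
    by (auto simp: indicator_def)
  then have "(\<integral>\<^sup>+v\<in>D_reg r. ennreal (chord_density r v) \<partial>lborel) \<le>
      (\<integral>\<^sup>+v. 2 * indicator (cbox (0, 0) (1 :: real, 1 :: real)) v \<partial>lborel)"
    by (rule nn_integral_mono)
  also have "\<dots> = 2 * emeasure lborel (cbox (0, 0) (1 :: real, 1 :: real))"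
    by (simp add: nn_integral_cmult)
  also have "\<dots> < \<infinity>"
    using emeasure_lborel_cbox_finite[of "(0, 0)" "(1 :: real, 1 :: real)"] by (simp add: ennreal_mult_less_top)
  finally show ?thesis .
qed

theorem theorem1p5:
  fixes r :: real
  assumes "r \<ge> 0"
  shows "L2_norm_sq (siegel_pr (f_ind r)) =
    8 / zeta2 * (exp (-2 * r) +
      (LINT v:D_reg r|lborel. exp (-r) / fst v + exp (-r) / snd v - 1 / (fst v * snd v)))"
proof -
  note borel_measurable_siegel_pr[measurable]
  define I where "I = (\<integral>\<^sup>+v\<in>D_reg r. ennreal (chord_density r v) \<partial>lborel)"
  \<comment> \<open>\<open>enn2real\<close> sends infinity to 0, so finiteness is what lets it pass
    through the sum below.\<close>
  have fin: "I < \<infinity>" unfolding I_def by (rule nn_integral_chord_density_finite[OF assms])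
  have "(LINT v:D_reg r|lborel. exp (-r) / fst v + exp (-r) / snd v - 1 / (fst v * snd v)) =
      (\<integral>v. indicator (D_reg r) v * chord_density r v \<partial>lborel)"
    by (simp add: set_lebesgue_integral_def chord_density_def)
  also have "\<dots> = enn2real (\<integral>\<^sup>+v. ennreal (indicator (D_reg r) v * chord_density r v) \<partial>lborel)"
    by (rule integral_eq_nn_integral)
      (use chord_density_D_reg(1)[OF _ assms] in \<open>auto simp: indicator_def\<close>)
  also have "(\<integral>\<^sup>+v. ennreal (indicator (D_reg r) v * chord_density r v) \<partial>lborel) = I"
    unfolding I_def by (rule nn_integral_cong) (auto simp: indicator_def)
  finally have D: "(LINT v:D_reg r|lborel. exp (-r) / fst v + exp (-r) / snd v - 1 / (fst v * snd v)) = enn2real I" .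
  have "L2_norm_sq (siegel_pr (f_ind r)) =
      enn2real (\<integral>\<^sup>+p. ennreal ((siegel_pr (f_ind r) (lattice_coord p))\<^sup>2) \<partial>mu_X)"
    unfolding L2_norm_sq_def by (rule integral_eq_nn_integral) (simp_all add: mu_X_def)
  also have "\<dots> = enn2real (ennreal (6 / pi\<^sup>2) * (4 * (2 * (ennreal ((exp (- r))\<^sup>2) + I))))"
    unfolding nn_integral_siegel_square_unfolded[OF assms] nn_integral_basis_weight
      nn_integral_half_square[OF assms] I_def ..
  also have "\<dots> = 6 / pi\<^sup>2 * (4 * (2 * ((exp (- r))\<^sup>2 + enn2real I)))"
  proof -
    obtain i where i: "I = ennreal i" "0 \<le> i" using fin by (cases I) auto
    have "ennreal (6 / pi\<^sup>2) * (4 * (2 * (ennreal ((exp (- r))\<^sup>2) + I))) =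
        ennreal (6 / pi\<^sup>2 * (4 * (2 * ((exp (- r))\<^sup>2 + i))))"
      using i(2) by (simp add: i(1) flip: ennreal_mult ennreal_plus ennreal_numeral)
    then show ?thesis using i by simp
  qed
  \<comment> \<open>The constants combine to \<open>48 / pi\<^sup>2 = 8 / zeta2\<close>.\<close>
  also have "\<dots> = 8 / zeta2 * (exp (- 2 * r) + enn2real I)"
    by (simp add: zeta2_def flip: exp_double)
  finally show ?thesis unfolding D .
qed

end
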